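(* Let $G_1$ and $G_2$ be finite simple connected graphs, let $Y$ be a nonempty graph which is a full subgraph of both $G_1$ and $G_2$, and let $G = G_1\cup_Y G_2$. Then the number of spanning trees satisfies $$\tau(G)=\tau(G_1)\,\tau(G_2)\,C(G_1,G_2,Y),$$ where $$C(G_1,G_2,Y)=\frac{|V(Y)|\;{\det}'\big(\mathrm{DN}(G_1,Y,G_2)\big)}{{\det}'\big(\mathrm{DN}(G_1,Y)\big)\,{\det}'\big(\mathrm{DN}(G_2,Y)\big)}$$ and $\mathrm{DN}(G_1,Y,G_2)=\mathrm{DN}(G_1,Y)+\mathrm{DN}(G_2,Y)-L(Y)$.
   Context: $\tau(H)$ denotes the number of spanning trees of $H$. For a square matrix $M$, the pseudo-determinant ${\det}'(M)$ is the product of the non-zero eigenvalues of $M$ (with multiplicity; an empty product is $1$). A subgraph $Y$ of a graph $H$ is full if $u,v\in V(Y)$ and $\{u,v\}\in E(H)$ imply $\{u,v\}\in E(Y)$. If $Y$ is a full subgraph of $G_1$ and of $G_2$, then $G_1\cup_Y G_2$ is the graph obtained from the disjoint union of $G_1$ and $G_2$ by identifying the two copies of each vertex of $Y$ and the two copies of each edge of $Y$. $L(H)$ is the graph Laplacian: $L(H)(u,u)$ is the degree of $u$ in $H$, $L(H)(u,v)=-1$ if $\{u,v\}\in E(H)$, and $0$ otherwise. Dirichlet-to-Neumann map: for a finite simple connected graph $H$ and a nonempty full subgraph $Y$ of $H$, write $L(H)=\begin{bmatrix} A & B\\ B^T & D\end{bmatrix}$ with $A$ indexed by $V(H)\setminus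 V(Y)$ and $D$ by $V(Y)$. Then $A$ is invertible and $\mathrm{DN}(H,Y)=D-B^TA^{-1}B$, a matrix indexed by $V(Y)$. *)

theory Defs
  imports
    "HOL-Library.Countable_Set"
    "Jordan_Normal_Form.Gauss_Jordan_Elimination"
    "Jordan_Normal_Form.Spectral_Radius"
begin

section \<open>Simple graphs\<close>

record 'a ugraph =
  uverts :: "'a set"
  uedges :: "'a set set"

definition simple_graph :: "'a ugraph \<Rightarrow> bool" where
  "simple_graph G \<longleftrightarrow> (\<forall>e\<in>uedges G. e \<subseteq> uverts G \<and> card e = 2)"

definition fin_simple_graph :: "'a ugraph \<Rightarrow> bool" where
  "fin_simple_graph G \<longleftrightarrow> simple_graph G \<and> finite (uverts G)"

definition uadj :: "'a ugraph \<Rightarrow> ('a \<times> 'a) set" where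
  "uadj G = {(u, v). {u, v} \<in> uedges G}"

definition uconnected :: "'a ugraph \<Rightarrow> bool" where
  "uconnected G \<longleftrightarrow> uverts G \<noteq> {} \<and> (\<forall>u\<in>uverts G. \<forall>v\<in>uverts G. (u, v) \<in> (uadj G)\<^sup>*)"

text \<open>A cycle is the cyclic sequence of its vertices, which are pairwise distinct.\<close>

definition ucycle :: "'a ugraph \<Rightarrow> 'a list \<Rightarrow> bool" where
  "ucycle G vs \<longleftrightarrow> 3 \<le> length vs \<and> distinct vs \<and>
     (\<forall>i<length vs. {vs ! i, vs ! (Suc i mod length vs)} \<in> uedges G)"

definition utree :: "'a ugraph \<Rightarrow> bool" where
  "utree T \<longleftrightarrow> uconnected T \<and> (\<nexists>vs. ucycle T vs)"

definition usubgraph :: "'a ugraph \<Rightarrow> 'a ugraph \<Rightarrow> bool" where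
  "usubgraph Y G \<longleftrightarrow> simple_graph Y \<and> uverts Y \<subseteq> uverts G \<and> uedges Y \<subseteq> uedges G"

definition full_subgraph :: "'a ugraph \<Rightarrow> 'a ugraph \<Rightarrow> bool" where
  "full_subgraph Y G \<longleftrightarrow> usubgraph Y G \<and>
     (\<forall>u\<in>uverts Y. \<forall>v\<in>uverts Y. {u, v} \<in> uedges G \<longrightarrow> {u, v} \<in> uedges Y)"

definition uspanning_tree :: "'a ugraph \<Rightarrow> 'a ugraph \<Rightarrow> bool" where
  "uspanning_tree T G \<longleftrightarrow> usubgraph T G \<and> uverts T = uverts G \<and> utree T"

definition num_spanning_trees :: "'a ugraph \<Rightarrow> nat" where
  "num_spanning_trees G = card {T. uspanning_tree T G}"


section \<open>Gluing along a common subgraph\<close>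

definition map_ugraph :: "('a \<Rightarrow> 'b) \<Rightarrow> 'a ugraph \<Rightarrow> 'b ugraph" where
  "map_ugraph f G = \<lparr>uverts = f ` uverts G, uedges = (\<lambda>e. f ` e) ` uedges G\<rparr>"

definition disjoint_union :: "'a ugraph \<Rightarrow> 'b ugraph \<Rightarrow> ('a + 'b) ugraph" where
  "disjoint_union G1 G2 =
     \<lparr>uverts = uverts G1 <+> uverts G2,
      uedges = (\<lambda>e. Inl ` e) ` uedges G1 \<union> (\<lambda>e. Inr ` e) ` uedges G2\<rparr>"

text \<open>
  The two copies of a vertex of \<open>Y\<close> are identified by choosing the left copy as their common
  representative. Since edges are sets of vertices, this also identifies the two copies of
  each edge of \<open>Y\<close>. Outside \<open>Y\<close> the vertices stay distinct, even if \<open>G1\<close> and \<open>G2\<close> happen to share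
  further vertices.
\<close>

fun identify_copies :: "'a ugraph \<Rightarrow> 'a + 'a \<Rightarrow> 'a + 'a" where
  "identify_copies Y (Inl v) = Inl v"
| "identify_copies Y (Inr v) = (if v \<in> uverts Y then Inl v else Inr v)"

definition glue :: "'a ugraph \<Rightarrow> 'a ugraph \<Rightarrow> 'a ugraph \<Rightarrow> ('a + 'a) ugraph" where
  "glue G1 Y G2 = map_ugraph (identify_copies Y) (disjoint_union G1 G2)"


section \<open>Laplacian and Dirichlet-to-Neumann map\<close>

definition udegree :: "'a ugraph \<Rightarrow> 'a \<Rightarrow> nat" where
  "udegree G u = card {e \<in> uedges G. u \<in> e}"

definition laplacian_entry :: "'a ugraph \<Rightarrow> 'a \<Rightarrow> 'a \<Rightarrow> real" where
  "laplacian_entry G u v =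
     (if u = v then real (udegree G u) else if {u, v} \<in> uedges G then -1 else 0)"

text \<open>
  A matrix with rows indexed by a finite set \<open>S\<close> and columns by a finite set \<open>T\<close> is represented
  by listing \<open>S\<close> and \<open>T\<close> in the order given by \<^const>\<open>from_nat_into\<close>, which restricts to a
  bijection from \<open>{..<card S}\<close> to \<open>S\<close>. The order depends on the set only, so all matrices
  indexed by the same set are compatible; eigenvalues do not depend on it.
\<close>

definition laplacian_block :: "'a ugraph \<Rightarrow> 'a set \<Rightarrow> 'a set \<Rightarrow> real mat" where
  "laplacian_block G S T =
     mat (card S) (card T) (\<lambda>(i, j). laplacian_entry G (from_nat_into S i) (from_nat_into T j))"

definition laplacian :: "'a ugraph \<Rightarrow> real mat" where
  "laplacian G = laplacian_block G (uverts G) (uverts G)"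

definition DN :: "'a ugraph \<Rightarrow> 'a ugraph \<Rightarrow> real mat" where
  "DN H Y =
     (let I = uverts H - uverts Y;
          A = laplacian_block H I I;
          B = laplacian_block H I (uverts Y);
          D = laplacian_block H (uverts Y) (uverts Y)
      in D - transpose_mat B * the (mat_inverse A) * B)"

definition DN_glue :: "'a ugraph \<Rightarrow> 'a ugraph \<Rightarrow> 'a ugraph \<Rightarrow> real mat" where
  "DN_glue G1 Y G2 = DN G1 Y + DN G2 Y - laplacian Y"


section \<open>Pseudo-determinant\<close>

text \<open>Eigenvalues are taken over the complex numbers, with algebraic multiplicity.\<close>

definition pseudo_det :: "real mat \<Rightarrow> complex" where
  "pseudo_det M =
     (let M' = map_mat complex_of_real M
      in \<Prod>k \<in> spectrum M' - {0}. k ^ Polynomial.order k (char_poly M'))"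

definition glue_factor :: "'a ugraph \<Rightarrow> 'a ugraph \<Rightarrow> 'a ugraph \<Rightarrow> complex" where
  "glue_factor G1 G2 Y =
     of_nat (card (uverts Y)) * pseudo_det (DN_glue G1 Y G2) /
     (pseudo_det (DN G1 Y) * pseudo_det (DN G2 Y))"

end

theory Submission
  imports Defs
begin

text \<open>
  Let \<open>A\<^sub>H\<close> be the block of the Laplacian \<open>L(H)\<close> on the vertices outside \<open>Y\<close>. The proof evaluates a
  principal minor of a Laplacian in two ways.

  Remove one vertex of \<open>Y\<close> from \<open>L(H)\<close>. By the matrix-tree theorem (\<open>matrix_tree\<close>) the determinant that
  remains is \<open>\<tau>(H)\<close>. Since \<open>DN(H,Y)\<close> is the Schur complement of \<open>A\<^sub>H\<close> (\<open>det_schur_complement\<close>), the same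
  determinant is \<open>det A\<^sub>H\<close> times a principal minor of \<open>DN(H,Y)\<close>. The matrix \<open>DN(H,Y)\<close> is symmetric and its
  rows sum to zero; for such a matrix of size \<open>n\<close>, if deleting one row and the same column leaves a
  non-zero determinant, then the product of the non-zero eigenvalues is \<open>n\<close> times this determinant
  (\<open>pseudo_det_zero_line_sums\<close>). Together,

    \<open>det A\<^sub>H \<cdot> det'(DN(H,Y)) = |V(Y)| \<cdot> \<tau>(H)\<close>.

  In the glued graph \<open>G\<close> no edge joins the two interiors, so its interior block is block diagonal with
  blocks \<open>A\<^sub>1\<close> and \<open>A\<^sub>2\<close>. On \<open>Y\<close>, the Laplacians of \<open>G\<^sub>1\<close> and \<open>G\<^sub>2\<close> add up, except that \<open>L(Y)\<close> is counted twice.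
  Hence \<open>DN(G\<^sub>1,Y,G\<^sub>2)\<close> is the Schur complement for \<open>G\<close>, and likewise

    \<open>det A\<^sub>1 \<cdot> det A\<^sub>2 \<cdot> det'(DN(G\<^sub>1,Y,G\<^sub>2)) = |V(Y)| \<cdot> \<tau>(G)\<close>.

  Dividing this by the product of the identities for \<open>G\<^sub>1\<close> and \<open>G\<^sub>2\<close> cancels the interior determinants and leaves the
  claim.

  The matrix-tree theorem itself is obtained by expanding a principal minor along the splitting of
  each row into differences \<open>e\<^sub>u - e\<^sub>w\<close>, one for each neighbour \<open>w\<close> of \<open>u\<close>. A choice of one neighbour for
  each vertex contributes \<open>1\<close> if it describes a forest rooted at the removed vertices and \<open>0\<close>
  otherwise (\<open>det_laplacian_rooted_forests\<close>). In a connected graph such forests exist, so the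
  interior blocks are invertible and the numbers of spanning trees are non-zero.
\<close>

section \<open>Schur complements and pseudo-determinants\<close>

lemma transpose_mult_mult_index:
  fixes X W :: "'a::comm_ring_1 mat"
  assumes "X \<in> carrier_mat m n" "W \<in> carrier_mat m m" "i < n" "j < n"
  shows "(transpose_mat X * W * X) $$ (i, j) = (\<Sum>a<m. \<Sum>b<m. X $$ (a, i) * W $$ (a, b) * X $$ (b, j))"
proof -
  have "(transpose_mat X * W * X) $$ (i, j) = (\<Sum>b<m. (\<Sum>a<m. X $$ (a, i) * W $$ (a, b)) * X $$ (b, j))"
  proof -
    have "(transpose_mat X * W * X) $$ (i, j) = (\<Sum>b<m. (transpose_mat X * W) $$ (i, b) * X $$ (b, j))"
      using assms by (subst index_mult_mat) (auto simp: scalar_prod_def atLeast0LessThan intro!: sum.cong)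
    also have "\<dots> = (\<Sum>b<m. (\<Sum>a<m. X $$ (a, i) * W $$ (a, b)) * X $$ (b, j))"
      using assms by (intro sum.cong) (auto simp: scalar_prod_def atLeast0LessThan)
    finally show ?thesis .
  qed
  also have "\<dots> = (\<Sum>b<m. \<Sum>a<m. X $$ (a, i) * W $$ (a, b) * X $$ (b, j))"
    by (simp add: sum_distrib_right)
  also have "\<dots> = (\<Sum>a<m. \<Sum>b<m. X $$ (a, i) * W $$ (a, b) * X $$ (b, j))"
    by (rule sum.swap)
  finally show ?thesis .
qed

text \<open>
  Block elimination: the matrix with blocks \<open>A\<close>, \<open>B\<close>, \<open>C\<close>, \<open>D\<close> is the product of a block lower
  triangular matrix with diagonal \<open>A\<close>, \<open>1\<close> and a block upper triangular one with diagonal \<open>1\<close> and the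
  Schur complement. The inverse \<open>W\<close> is a parameter, so that any description of it can be plugged in.
\<close>

lemma det_schur_complement:
  fixes A :: "'a::idom mat"
  assumes A: "A \<in> carrier_mat m m" and W: "W \<in> carrier_mat m m"
    and AW: "A * W = 1\<^sub>m m"
    and B: "B \<in> carrier_mat m n" and C: "C \<in> carrier_mat n m" and D: "D \<in> carrier_mat n n"
  shows "det (four_block_mat A B C D) = det A * det (D - C * W * B)"
proof -
  let ?S = "D - C * W * B"
  have "four_block_mat A (0\<^sub>m m n) C (1\<^sub>m n) * four_block_mat (1\<^sub>m m) (W * B) (0\<^sub>m n m) ?S
     = four_block_mat (A * 1\<^sub>m m + 0\<^sub>m m n * 0\<^sub>m n m) (A * (W * B) + 0\<^sub>m m n * ?S)
        (C * 1\<^sub>m m + 1\<^sub>m n * 0\<^sub>m n m) (C * (W * B) + 1\<^sub>m n * ?S)"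
    by (rule mult_four_block_mat) (use assms in auto)
  also have "\<dots> = four_block_mat A B C D"
  proof (rule cong_four_block_mat)
    show "A * (W * B) + 0\<^sub>m m n * ?S = B"
      using assms by (simp add: assoc_mult_mat[symmetric, of A m m W m B n])
    show "C * (W * B) + 1\<^sub>m n * ?S = D"
    proof -
      have "C * (W * B) = C * W * B" using C W B by (simp add: assoc_mult_mat)
      then show ?thesis using assms by (intro eq_matI) auto
    qed
  qed (use assms in auto)
  finally have "det (four_block_mat A B C D) =
      det (four_block_mat A (0\<^sub>m m n) C (1\<^sub>m n)) * det (four_block_mat (1\<^sub>m m) (W * B) (0\<^sub>m n m) ?S)"
    using assms by (subst det_mult[symmetric, of _ "m + n"]) (auto intro!: four_block_carrier_mat)
  also have "det (four_block_mat A (0\<^sub>m m n) C (1\<^sub>m n)) = det A"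
    using assms by (subst det_four_block_mat_upper_right_zero) auto
  also have "det (four_block_mat (1\<^sub>m m) (W * B) (0\<^sub>m n m) ?S) = det ?S"
    using assms by (subst det_four_block_mat_lower_left_zero) auto
  finally show ?thesis .
qed

definition truncate_mat :: "'a mat \<Rightarrow> 'a mat" where
  "truncate_mat M = mat (dim_row M - 1) (dim_col M - 1) (\<lambda>(i, j). M $$ (i, j))"

definition ones :: "nat \<Rightarrow> 'a::one vec" where
  "ones n = vec n (\<lambda>_. 1)"

lemma zero_row_sums:
  fixes M :: "'a::comm_ring_1 mat"
  assumes "M \<in> carrier_mat n n" "M *\<^sub>v ones n = 0\<^sub>v n" "i < n"
  shows "(\<Sum>j<n. M $$ (i, j)) = 0"
proof -
  have "(M *\<^sub>v ones n) $ i = (\<Sum>j<n. M $$ (i, j))"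
    using assms(1,3) by (auto simp: ones_def scalar_prod_def atLeast0LessThan intro!: sum.cong)
  then show ?thesis using assms by simp
qed

text \<open>
  Adding all columns to the last one clears that column except for the corner, where the ones of
  the last row add up to the size of the matrix.
\<close>

lemma det_last_row_ones:
  fixes M :: "'a::idom mat"
  assumes M: "M \<in> carrier_mat (Suc q) (Suc q)"
    and row: "\<And>i. i < q \<Longrightarrow> (\<Sum>j<Suc q. M $$ (i, j)) = 0"
    and last: "\<And>j. j < Suc q \<Longrightarrow> M $$ (q, j) = 1"
  shows "det M = of_nat (Suc q) * det (truncate_mat M)"
proof -
  let ?n = "Suc q"
  \<comment> \<open>Multiplication by \<open>E\<close> from the right adds all columns to the last one.\<close>
  define E where "E = mat ?n ?n (\<lambda>(i, j). if i = j \<or> j = q then 1 else (0::'a))"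
  have E: "E \<in> carrier_mat ?n ?n" by (simp add: E_def)
  have "det E = 1"
    by (subst det_upper_triangular[OF _ E]) (auto simp: E_def prod_list_diag_prod upper_triangular_def)
  define F where "F = four_block_mat (truncate_mat M) (0\<^sub>m q 1) (mat 1 q (\<lambda>_. 1)) (mat 1 1 (\<lambda>_. of_nat ?n))"
  have "M * E = F"
  proof (rule eq_matI)
    fix i j assume ij: "i < dim_row F" "j < dim_col F"
    then have i: "i < ?n" and j: "j < ?n" using M by (auto simp: F_def truncate_mat_def)
    have ME: "(M * E) $$ (i, j) = (\<Sum>k<?n. M $$ (i, k) * (if k = j \<or> j = q then 1 else 0))"
      using M i j by (auto simp: scalar_prod_def E_def atLeast0LessThan intro!: sum.cong)
    show "(M * E) $$ (i, j) = F $$ (i, j)"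
    proof (cases "j = q")
      case True
      have "(M * E) $$ (i, j) = (\<Sum>k<?n. M $$ (i, k))" using ME True by simp
      then show ?thesis
        using True i row[of i] last M by (cases "i = q") (auto simp: F_def truncate_mat_def)
    next
      case False
      have "(M * E) $$ (i, j) = M $$ (i, j)"
        using ME False j by (simp add: sum.delta' if_distrib cong: if_cong)
      then show ?thesis
        using False i j M last[of j] by (cases "i = q") (auto simp: F_def truncate_mat_def)
    qed
  qed (use M in \<open>auto simp: F_def E_def truncate_mat_def\<close>)
  then have "det M * det E = det F" using det_mult[OF M E] by simp
  also have "det F = det (truncate_mat M) * det (mat 1 1 (\<lambda>_. of_nat ?n :: 'a))"
    unfolding F_def using M
    by (intro det_four_block_mat_upper_right_zero[where n = q]) (auto simp: truncate_mat_def)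
  also have "det (mat 1 1 (\<lambda>_. of_nat ?n :: 'a)) = of_nat ?n"
    by (subst det_upper_triangular[where n = 1]) (auto simp: prod_list_diag_prod)
  finally show ?thesis using \<open>det E = 1\<close> by simp
qed

text \<open>
  Why the size of the matrix enters: adding all rows of \<open>X \<cdot> 1 - M\<close> to the last one turns that row
  into \<open>(X, \<dots>, X)\<close>, because the columns of \<open>M\<close> sum to zero. Taking out the factor \<open>X\<close> leaves a matrix
  that has, at \<open>X = 0\<close>, zero row sums above a last row of ones.
\<close>

lemma char_poly_zero_line_sums:
  fixes M :: "'a::idom mat"
  assumes M: "M \<in> carrier_mat (Suc q) (Suc q)" and sym: "transpose_mat M = M"
    and ker: "M *\<^sub>v ones (Suc q) = 0\<^sub>v (Suc q)"
  obtains p where "char_poly M = [:0, 1:] * p"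
    and "poly p 0 = (-1) ^ q * of_nat (Suc q) * det (truncate_mat M)"
proof -
  let ?n = "Suc q"
  define P where "P = char_poly_matrix M"
  have P: "P \<in> carrier_mat ?n ?n" using M by (simp add: P_def)
  have P_entry: "P $$ (i, j) = (if i = j then [:0, 1:] else 0) + [:- M $$ (i, j):]"
    if "i < ?n" "j < ?n" for i j
    using that M by (simp add: P_def char_poly_matrix_def)
  have rows: "(\<Sum>j<?n. M $$ (i, j)) = 0" if "i < ?n" for i
    using zero_row_sums[OF M ker that] .
  have cols: "(\<Sum>i<?n. M $$ (i, j)) = 0" if "j < ?n" for j
  proof -
    have "M $$ (i, j) = M $$ (j, i)" if "i < ?n" for i
      using M sym \<open>j < ?n\<close> that index_transpose_mat(1)[of i M j] by simp
    then show ?thesis using rows[OF that] by simp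
  qed
  \<comment> \<open>The matrix that is left once the factor \<open>X\<close> is taken out of the last row.\<close>
  define N where "N = mat ?n ?n (\<lambda>(i, j). if i = q then 1 else P $$ (i, j))"
  have N: "N \<in> carrier_mat ?n ?n" by (simp add: N_def)
  \<comment> \<open>Multiplication by \<open>E\<close> from the left adds all rows to the last one.\<close>
  define E where "E = mat ?n ?n (\<lambda>(i, j). if i = j \<or> i = q then 1 else (0::'a poly))"
  have E: "E \<in> carrier_mat ?n ?n" by (simp add: E_def)
  have "det E = 1"
    by (subst det_lower_triangular[OF _ E]) (auto simp: E_def prod_list_diag_prod)
  have "E * P = multrow q [:0, 1:] N"
  proof (rule eq_matI)
    fix i j assume "i < dim_row (multrow q [:0, 1:] N)" "j < dim_col (multrow q [:0, 1:] N)"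
    then have i: "i < ?n" and j: "j < ?n" by (auto simp: N_def)
    have EP: "(E * P) $$ (i, j) = (\<Sum>k<?n. (if i = k \<or> i = q then 1 else 0) * P $$ (k, j))"
      using P i j by (auto simp: scalar_prod_def E_def atLeast0LessThan intro!: sum.cong)
    show "(E * P) $$ (i, j) = multrow q [:0, 1:] N $$ (i, j)"
    proof (cases "i = q")
      case True
      have "(E * P) $$ (i, j) = (\<Sum>k<?n. P $$ (k, j))" using EP True by simp
      also have "\<dots> = (\<Sum>k<?n. (if k = j then [:0, 1:] else 0) + [:- M $$ (k, j):])"
        using j by (intro sum.cong) (auto simp: P_entry)
      also have "\<dots> = [:0, 1:] + [:- (\<Sum>k<?n. M $$ (k, j)):]"
        using j by (simp add: sum.distrib sum_to_poly sum_negf[symmetric] del: sum.lessThan_Suc)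
      also have "\<dots> = [:0, 1:]" using cols[OF j] by simp
      finally show ?thesis using True j by (simp add: N_def)
    next
      case False
      have "(E * P) $$ (i, j) = P $$ (i, j)"
        using EP False i by (simp add: if_distrib[of "\<lambda>x. x * _"] sum.delta cong: if_cong)
      then show ?thesis using False i j by (simp add: N_def)
    qed
  qed (use P in \<open>auto simp: E_def N_def\<close>)
  then have "det P = [:0, 1:] * det N"
    using det_mult[OF E P] \<open>det E = 1\<close> det_multrow[OF _ N, of q] by simp
  moreover have "poly (det N) 0 = (-1) ^ q * of_nat ?n * det (truncate_mat M)"
  proof -
    define N0 where "N0 = map_mat (\<lambda>p. poly p 0) N"
    have N0: "N0 \<in> carrier_mat ?n ?n" using N by (simp add: N0_def)
    have entry: "N0 $$ (i, j) = (if i = q then 1 else - M $$ (i, j))" if "i < ?n" "j < ?n" for i j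
      using that by (simp add: N0_def N_def P_entry)
    have "poly (det N) 0 = det N0" unfolding N0_def by (rule comm_ring_hom.hom_det[OF poly_hom.comm_ring_hom_axioms, symmetric])
    also have "\<dots> = of_nat ?n * det (truncate_mat N0)"
    proof (rule det_last_row_ones[OF N0])
      fix i assume i: "i < q"
      have "(\<Sum>j<?n. N0 $$ (i, j)) = - (\<Sum>j<?n. M $$ (i, j))"
        unfolding sum_negf[symmetric] using i by (intro sum.cong) (auto simp: entry)
      then show "(\<Sum>j<?n. N0 $$ (i, j)) = 0" using rows[of i] i by (simp del: sum.lessThan_Suc)
    qed (simp add: entry)
    also have "truncate_mat N0 = (-1) \<cdot>\<^sub>m truncate_mat M"
      using M N0 by (intro eq_matI) (auto simp: truncate_mat_def entry)
    also have "det \<dots> = (-1) ^ q * det (truncate_mat M)"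
      using M by (simp add: truncate_mat_def)
    finally show ?thesis by simp
  qed
  ultimately show ?thesis using that by (simp add: char_poly_def P_def)
qed

text \<open>
  A non-zero minor makes \<open>0\<close> a simple root of the characteristic polynomial. Up to sign, the product
  of the other roots is then the value at \<open>0\<close> of the polynomial divided by \<open>X\<close>.
\<close>

lemma pseudo_det_zero_line_sums:
  fixes M :: "real mat"
  assumes M: "M \<in> carrier_mat (Suc q) (Suc q)" and sym: "transpose_mat M = M"
    and ker: "M *\<^sub>v ones (Suc q) = 0\<^sub>v (Suc q)"
    and nz: "det (truncate_mat M) \<noteq> 0"
  shows "pseudo_det M = of_real (of_nat (Suc q) * det (truncate_mat M))"
proof -
  let ?n = "Suc q"
  define c where "c = char_poly (map_mat complex_of_real M)"
  have M': "map_mat complex_of_real M \<in> carrier_mat ?n ?n" using M by simp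
  have monic: "lead_coeff c = 1" and deg: "degree c = ?n"
    using degree_monic_char_poly[OF M'] by (auto simp: c_def)
  then have "c \<noteq> 0" by auto
  obtain p0 where p0: "char_poly M = [:0, 1:] * p0"
    "poly p0 0 = (-1) ^ q * of_nat ?n * det (truncate_mat M)"
    using char_poly_zero_line_sums[OF M sym ker] by blast
  define p where "p = map_poly complex_of_real p0"
  interpret mp: map_poly_comm_ring_hom complex_of_real ..
  have c_p: "c = [:0, 1:] * p"
    unfolding c_def p_def of_real_hom.char_poly_hom[OF M] p0(1) by (simp add: hom_distribs)
  have p_0: "poly p 0 = of_real ((-1) ^ q * of_nat ?n * det (truncate_mat M))"
    unfolding p0(2)[symmetric] p_def using of_real_hom.poly_map_poly[of p0 0] by simp
  then have p_nz: "poly p 0 \<noteq> 0" using nz by (simp del: of_nat_Suc)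
  have "Polynomial.order 0 c = 1"
  proof -
    have "Polynomial.order 0 c = Polynomial.order 0 [:0, 1::complex:] + Polynomial.order 0 p"
      using \<open>c \<noteq> 0\<close> unfolding c_p by (rule Polynomial.order_mult)
    also have "Polynomial.order 0 p = 0" using p_nz by (intro order_0I)
    also have "Polynomial.order 0 [:0, 1::complex:] = 1"
      using order_power_n_n[of "0::complex" 1] by simp
    finally show ?thesis by simp
  qed
  define Z where "Z = {z. poly c z = 0}"
  have "finite Z" unfolding Z_def using \<open>c \<noteq> 0\<close> by (rule poly_roots_finite)
  have "0 \<in> Z" by (simp add: Z_def c_p)
  have split: "c = [:0, 1:] * (\<Prod>z\<in>Z - {0}. [:- z, 1:] ^ Polynomial.order z c)"
    using complex_poly_decompose[of c] monic \<open>Polynomial.order 0 c = 1\<close>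
      prod.remove[OF \<open>finite Z\<close> \<open>0 \<in> Z\<close>, of "\<lambda>z. [:- z, 1:] ^ Polynomial.order z c"]
    by (simp add: Z_def)
  then have p_eq: "p = (\<Prod>z\<in>Z - {0}. [:- z, 1:] ^ Polynomial.order z c)"
    using c_p by simp
  have sum_order: "(\<Sum>z\<in>Z - {0}. Polynomial.order z c) = q"
  proof -
    have "degree p = (\<Sum>z\<in>Z - {0}. degree ([:- z, 1:] ^ Polynomial.order z c))"
      unfolding p_eq by (rule degree_prod_eq_sum_degree) simp
    also have "\<dots> = (\<Sum>z\<in>Z - {0}. Polynomial.order z c)" by (simp add: degree_linear_power)
    finally show ?thesis using deg c_p p_nz by (auto simp: degree_mult_eq split: if_splits)
  qed
  have "poly p 0 = (\<Prod>z\<in>Z - {0}. (- z) ^ Polynomial.order z c)"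
    unfolding p_eq by (simp add: poly_prod)
  also have "\<dots> = (\<Prod>z\<in>Z - {0}. (-1) ^ Polynomial.order z c * z ^ Polynomial.order z c)"
    by (intro prod.cong refl) (rule power_minus)
  also have "\<dots> = (-1) ^ q * (\<Prod>z\<in>Z - {0}. z ^ Polynomial.order z c)"
    by (simp add: prod.distrib power_sum[symmetric] sum_order)
  also have "(\<Prod>z\<in>Z - {0}. z ^ Polynomial.order z c) = pseudo_det M"
    unfolding pseudo_det_def Let_def Z_def c_def spectrum_def
    using eigenvalue_root_char_poly[OF M'] by (intro prod.cong) auto
  finally have "(-1) ^ q * pseudo_det M = (-1) ^ q * of_real (of_nat ?n * det (truncate_mat M))"
    using p_0 by (simp add: mult.assoc)
  then show ?thesis by simp
qed

section \<open>Principal minors of Laplacians count rooted forests\<close>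

definition nbrs :: "'a ugraph \<Rightarrow> 'a \<Rightarrow> 'a set" where
  "nbrs G u = {v. {u, v} \<in> uedges G}"

lemma simple_graph_edge:
  assumes "simple_graph G" "{u, v} \<in> uedges G"
  shows "u \<in> uverts G" "v \<in> uverts G" "u \<noteq> v"
proof -
  have "{u, v} \<subseteq> uverts G" "card {u, v} = 2"
    using assms by (auto simp only: simple_graph_def)
  then show "u \<in> uverts G" "v \<in> uverts G" "u \<noteq> v" by (auto simp: card_2_iff)
qed

lemma nbrs_subset: "simple_graph G \<Longrightarrow> nbrs G u \<subseteq> uverts G - {u}"
  using simple_graph_edge(2,3)[of G u] unfolding nbrs_def by blast

lemma finite_nbrs: "fin_simple_graph G \<Longrightarrow> finite (nbrs G u)"
  using nbrs_subset[of G u] finite_subset[of "nbrs G u" "uverts G - {u}"] by (simp add: fin_simple_graph_def)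

lemma udegree_nbrs:
  assumes "simple_graph G"
  shows "udegree G u = card (nbrs G u)"
proof -
  have "bij_betw (\<lambda>v. {u, v}) (nbrs G u) {e \<in> uedges G. u \<in> e}"
  proof (rule bij_betw_imageI)
    show "inj_on (\<lambda>v. {u, v}) (nbrs G u)"
      by (auto simp: inj_on_def doubleton_eq_iff)
    show "(\<lambda>v. {u, v}) ` nbrs G u = {e \<in> uedges G. u \<in> e}"
    proof (intro equalityI subsetI)
      fix e assume e: "e \<in> {e \<in> uedges G. u \<in> e}"
      then have "card e = 2" using assms by (simp add: simple_graph_def)
      then obtain v where "e = {u, v}" using e by (auto simp: card_2_iff)
      with e show "e \<in> (\<lambda>v. {u, v}) ` nbrs G u" by (auto simp: nbrs_def)
    qed (auto simp: nbrs_def)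
  qed
  then show ?thesis unfolding udegree_def using bij_betw_same_card by metis
qed

text \<open>
  Row \<open>u\<close> of the Laplacian is the sum over the neighbours \<open>w\<close> of \<open>u\<close> of the vectors \<open>e\<^sub>u - e\<^sub>w\<close>. This
  splitting is what a determinant, being linear in each row, gets expanded along.
\<close>

lemma laplacian_entry_sum_nbrs:
  assumes "fin_simple_graph G"
  shows "laplacian_entry G u v = (\<Sum>w\<in>nbrs G u. (if u = v then 1 else 0) - (if w = v then 1 else 0))"
proof -
  have "(\<Sum>w\<in>nbrs G u. if w = v then 1 else 0) = (if v \<in> nbrs G u then 1 else 0 :: real)"
    using finite_nbrs[OF assms] by simp
  moreover have "u \<notin> nbrs G u"
    using nbrs_subset[of G u] assms by (auto simp: fin_simple_graph_def)
  ultimately show ?thesis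
    using assms by (auto simp: laplacian_entry_def sum_subtractf udegree_nbrs fin_simple_graph_def nbrs_def)
qed

text \<open>
  A function \<open>f\<close> is grounded on \<open>S\<close> if iterating it leads out of \<open>S\<close> from every point of \<open>S\<close>. On a finite
  set this says that \<open>f\<close> has no cycle inside \<open>S\<close>. A rank that drops along \<open>f\<close> is the form in which the
  proofs use it.
\<close>

definition grounded :: "'a set \<Rightarrow> ('a \<Rightarrow> 'a) \<Rightarrow> bool" where
  "grounded S f \<longleftrightarrow> (\<exists>d::'a \<Rightarrow> nat. \<forall>u\<in>S. f u \<in> S \<longrightarrow> d (f u) < d u)"

text \<open>
  The witness is the set of all points whose orbits never leave \<open>S\<close>. If it were empty, then the
  number of steps it takes to leave \<open>S\<close> would be a rank.
\<close>

lemma not_groundedE: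
  assumes "\<not> grounded S f"
  obtains C where "C \<subseteq> S" "C \<noteq> {}" "\<And>u. u \<in> S \<Longrightarrow> f u \<in> C \<longleftrightarrow> u \<in> C"
proof -
  define g where "g = (\<lambda>u. if u \<in> S then f u else u)"
  define C where "C = {u. \<forall>t. (g ^^ t) u \<in> S}"
  define d where "d u = (LEAST t. (g ^^ t) u \<notin> S)" for u
  have step: "g u = f u" if "u \<in> S" for u
    using that by (simp add: g_def)
  have sub: "C \<subseteq> S"
  proof
    fix u assume "u \<in> C"
    then have "(g ^^ 0) u \<in> S" unfolding C_def by blast
    then show "u \<in> S" by simp
  qed
  have closed: "f u \<in> C \<longleftrightarrow> u \<in> C" if u: "u \<in> S" for u
  proof -
    have "(g ^^ Suc t) u = (g ^^ t) (f u)" for t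
      by (simp only: funpow_Suc_right o_apply step[OF u])
    moreover have "(\<forall>t. (g ^^ t) u \<in> S) \<longleftrightarrow> (\<forall>t. (g ^^ Suc t) u \<in> S)"
      using u by (metis funpow_0 not0_implies_Suc)
    ultimately show ?thesis by (simp add: C_def)
  qed
  have "C \<noteq> {}"
  proof
    assume "C = {}"
    have "d (f u) < d u" if u: "u \<in> S" for u
    proof -
      have leaves: "(g ^^ d u) u \<notin> S"
        unfolding d_def by (rule LeastI_ex) (use \<open>C = {}\<close> in \<open>auto simp: C_def\<close>)
      then obtain t where t: "d u = Suc t" using u by (cases "d u") auto
      have "(g ^^ t) (f u) \<notin> S"
        using leaves by (simp only: t funpow_Suc_right o_apply step[OF u] not_False_eq_True)
      then have "d (f u) \<le> t" unfolding d_def by (rule Least_le)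
      then show ?thesis using t by simp
    qed
    then have "grounded S f" unfolding grounded_def by blast
    then show False using assms by contradiction
  qed
  then show thesis using that sub closed by blast
qed

text \<open>
  The matrix is \<open>1 - P\<close>, where \<open>P\<close> is the part inside \<open>S\<close> of the adjacency matrix of the functional
  graph of \<open>f\<close>. A permutation with a non-zero contribution moves each point along \<open>f\<close> or leaves it
  in place. If \<open>f\<close> is grounded, then a moved point loses rank, while a permutation preserves the sum
  of all ranks, so only the identity contributes. Otherwise the indicator vector of a set of points
  that is closed under \<open>f\<close> and under preimages lies in the kernel.
\<close>

lemma det_functional:
  assumes e: "bij_betw e {..<m} S"
  shows "det (mat m m (\<lambda>(i, j). (if e i = e j then 1 else 0) - (if f (e i) = e j then 1 else 0)) :: real mat)
    = (if grounded S f then 1 else 0)" (is "det ?P = _")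
proof (cases "grounded S f")
  case True
  then obtain d where d: "\<And>u. u \<in> S \<Longrightarrow> f u \<in> S \<Longrightarrow> d (f u) < (d u :: nat)"
    unfolding grounded_def by blast
  have inj: "e i = e j \<longleftrightarrow> i = j" if "i < m" "j < m" for i j
    using e that by (auto simp: bij_betw_def inj_on_def)
  have mem: "e i \<in> S" if "i < m" for i
    using e that by (auto simp: bij_betw_def)
  have no_fix: "f (e i) \<noteq> e i" if "i < m" for i
    using d[of "e i"] mem[OF that] by auto
  have zero: "(\<Prod>i=0..<m. ?P $$ (i, p i)) = 0" if p: "p permutes {0..<m}" and "p \<noteq> id" for p
  proof (rule ccontr)
    assume nz: "(\<Prod>i=0..<m. ?P $$ (i, p i)) \<noteq> 0"
    have step: "p i = i \<or> e (p i) = f (e i)" if "i < m" for i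
    proof -
      have "p i < m" using permutes_in_image[OF p, of i] that by simp
      moreover have "?P $$ (i, p i) \<noteq> 0" using nz that by auto
      ultimately show ?thesis using that by (auto split: if_splits simp: inj)
    qed
    have le: "d (e (p i)) \<le> d (e i)" if "i < m" for i
    proof -
      have "p i < m" using permutes_in_image[OF p, of i] that by simp
      then show ?thesis using step[OF that] d[of "e i"] mem that by force
    qed
    obtain k where k: "k < m" "p k \<noteq> k"
      using p \<open>p \<noteq> id\<close> by (metis atLeastLessThan_iff eq_id_iff le0 permutes_not_in)
    have "d (e (p k)) < d (e k)"
    proof -
      have "p k < m" using permutes_in_image[OF p, of k] k by simp
      then show ?thesis using step[OF k(1)] k d[of "e k"] mem by metis
    qed
    then have "(\<Sum>i=0..<m. d (e (p i))) < (\<Sum>i=0..<m. d (e i))"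
      using le k by (intro sum_strict_mono_ex1) auto
    moreover have "(\<Sum>i=0..<m. d (e (p i))) = (\<Sum>i=0..<m. d (e i))"
      using sum.permute[OF p, of "\<lambda>i. d (e i)"] by (simp add: comp_def)
    ultimately show False by simp
  qed
  have "det ?P = (\<Sum>p\<in>{p. p permutes {0..<m}}. if p = id then 1 else 0)"
    unfolding det_def'[OF mat_carrier]
  proof (rule sum.cong[OF refl])
    fix p assume "p \<in> {p. p permutes {0..<m}}"
    then have p: "p permutes {0..<m}" by simp
    show "signof p * (\<Prod>i=0..<m. ?P $$ (i, p i)) = (if p = id then 1 else 0)"
    proof (cases "p = id")
      case True
      then show ?thesis by (simp add: no_fix)
    next
      case False
      then show ?thesis using zero[OF p] by simp
    qed
  qed
  also have "\<dots> = 1"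
    by (simp add: finite_permutations permutes_id)
  finally show ?thesis using True by simp
next
  case False
  then obtain C where C: "C \<subseteq> S" "C \<noteq> {}" "\<And>u. u \<in> S \<Longrightarrow> f u \<in> C \<longleftrightarrow> u \<in> C"
    by (rule not_groundedE) blast
  define v where "v = vec m (\<lambda>i. if e i \<in> C then 1 else (0::real))"
  have surj: "\<exists>j<m. e j = u" if "u \<in> S" for u
    using e that by (auto simp: bij_betw_def)
  have count: "(\<Sum>j<m. (if u = e j then 1 else 0) * v $ j) = (if u \<in> C then 1 else (0::real))" for u
  proof -
    have "(\<Sum>j<m. (if u = e j then 1 else 0) * v $ j) = (\<Sum>j<m. if u = e j then if e j \<in> C then 1 else 0 else 0)"
      by (intro sum.cong) (auto simp: v_def)
    also have "\<dots> = (\<Sum>w\<in>S. if u = w then if w \<in> C then 1 else 0 else 0)"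
      by (rule sum.reindex_bij_betw[OF e])
    also have "\<dots> = (if u \<in> C then 1 else 0)"
      using C(1) e bij_betw_finite[OF e] by (auto simp: sum.delta')
    finally show ?thesis .
  qed
  have "?P *\<^sub>v v = 0\<^sub>v m"
  proof (rule eq_vecI)
    fix i assume "i < dim_vec (0\<^sub>v m :: real vec)"
    then have i: "i < m" by simp
    then have "e i \<in> S" using e by (auto simp: bij_betw_def)
    have "(?P *\<^sub>v v) $ i = (\<Sum>j<m. ((if e i = e j then 1 else 0) - (if f (e i) = e j then 1 else 0)) * v $ j)"
      using i by (auto simp: scalar_prod_def v_def atLeast0LessThan intro!: sum.cong)
    also have "\<dots> = (if e i \<in> C then 1 else 0) - (if f (e i) \<in> C then 1 else 0)"
      unfolding left_diff_distrib sum_subtractf count by simp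
    also have "\<dots> = 0" using C(3)[OF \<open>e i \<in> S\<close>] by simp
    finally show "(?P *\<^sub>v v) $ i = 0\<^sub>v m $ i" using i by simp
  qed simp
  moreover have "v \<noteq> 0\<^sub>v m"
  proof -
    obtain u where "u \<in> C" using C(2) by blast
    then obtain j where "j < m" "e j = u" using surj C(1) by blast
    then have "v $ j = 1" "0\<^sub>v m $ j = (0::real)" using \<open>u \<in> C\<close> by (auto simp: v_def)
    then show ?thesis by auto
  qed
  moreover have "v \<in> carrier_vec m" by (simp add: v_def)
  ultimately have "det ?P = 0"
    by (subst det_0_iff_vec_prod_zero_field[of _ m]) auto
  then show ?thesis using False by simp
qed

text \<open>
  A forest whose roots lie outside \<open>S\<close> is encoded by the function that sends each vertex in \<open>S\<close> to its
  parent. Being extensional makes the encoding unique.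
\<close>

definition rooted_forests :: "'a ugraph \<Rightarrow> 'a set \<Rightarrow> ('a \<Rightarrow> 'a) set" where
  "rooted_forests G S = {f \<in> PiE S (nbrs G). grounded S f}"

lemma finite_PiE_nbrs:
  assumes "fin_simple_graph G" "finite S"
  shows "finite (PiE S (nbrs G))"
  using assms finite_nbrs by (intro finite_PiE) auto

text \<open>
  Expanding each row \<open>u\<close> as the sum of \<open>e\<^sub>u - e\<^sub>w\<close> over the neighbours \<open>w\<close> gives a sum over all choices \<open>f\<close>
  of one neighbour per vertex. The summand is the determinant of \<open>1 - P\<close> for \<open>f\<close>, which detects
  whether \<open>f\<close> is grounded. Allowing any enumeration \<open>e\<close> of \<open>S\<close> frees later proofs to order the vertices
  as their block matrices require.
\<close>

lemma det_laplacian_rooted_forests: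
  assumes G: "fin_simple_graph G" and e: "bij_betw e {..<m} S"
  shows "det (mat m m (\<lambda>(i, j). laplacian_entry G (e i) (e j))) = real (card (rooted_forests G S))"
proof -
  have fin: "finite S" using bij_betw_finite[OF e] by simp
  let ?h = "\<lambda>u w v. (if u = v then 1 else 0) - (if w = v then 1 else 0 :: real)"
  let ?F = "PiE S (nbrs G)"
  let ?L = "mat m m (\<lambda>(i, j). laplacian_entry G (e i) (e j))"
  let ?P = "\<lambda>f. mat m m (\<lambda>(i, j). ?h (e i) (f (e i)) (e j))"
  have expand: "(\<Prod>i=0..<m. ?L $$ (i, p i)) = (\<Sum>f\<in>?F. \<Prod>i=0..<m. ?P f $$ (i, p i))"
    if p: "p permutes {0..<m}" for p
  proof -
    have pm: "p i < m" if "i < m" for i using permutes_in_image[OF p, of i] that by simp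
    \<comment> \<open>The permutation \<open>p\<close> of indices, transported to the vertices.\<close>
    define q where "q = (\<lambda>u. e (p (the_inv_into {..<m} e u)))"
    have q: "q (e i) = e (p i)" if "i < m" for i
      using e that by (simp add: q_def bij_betw_def the_inv_into_f_f)
    have "(\<Prod>i=0..<m. ?L $$ (i, p i)) = (\<Prod>i<m. \<Sum>w\<in>nbrs G (e i). ?h (e i) w (q (e i)))"
      unfolding atLeast0LessThan
      by (intro prod.cong) (auto simp: pm q laplacian_entry_sum_nbrs[OF G])
    also have "\<dots> = (\<Prod>u\<in>S. \<Sum>w\<in>nbrs G u. ?h u w (q u))"
      by (rule prod.reindex_bij_betw[OF e])
    also have "\<dots> = (\<Sum>f\<in>?F. \<Prod>u\<in>S. ?h u (f u) (q u))"
      using fin finite_nbrs[OF G] by (intro prod_sum_PiE) auto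
    also have "\<dots> = (\<Sum>f\<in>?F. \<Prod>i<m. ?h (e i) (f (e i)) (q (e i)))"
      by (intro sum.cong refl prod.reindex_bij_betw[OF e, symmetric])
    also have "\<dots> = (\<Sum>f\<in>?F. \<Prod>i=0..<m. ?P f $$ (i, p i))"
      unfolding atLeast0LessThan by (intro sum.cong prod.cong refl) (auto simp: pm q)
    finally show ?thesis .
  qed
  have "det ?L = (\<Sum>p\<in>{p. p permutes {0..<m}}. \<Sum>f\<in>?F. signof p * (\<Prod>i=0..<m. ?P f $$ (i, p i)))"
    unfolding det_def'[OF mat_carrier]
    by (intro sum.cong refl) (simp only: mem_Collect_eq expand sum_distrib_left)
  also have "\<dots> = (\<Sum>f\<in>?F. det (?P f))"
    unfolding det_def'[OF mat_carrier] by (rule sum.swap)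
  also have "\<dots> = (\<Sum>f\<in>?F. if grounded S f then 1 else 0)"
    by (intro sum.cong refl det_functional[OF e])
  also have "\<dots> = real (card (rooted_forests G S))"
    using finite_PiE_nbrs[OF G fin] by (simp add: rooted_forests_def sum.If_cases Int_def conj_commute)
  finally show ?thesis .
qed

text \<open>
  The distance to \<open>r\<close> is the rank, and a parent is a neighbour that is one step closer.
\<close>

lemma connected_parent_function:
  assumes conn: "uconnected G" and r: "r \<in> uverts G"
  obtains d :: "'a \<Rightarrow> nat" and f
  where "\<And>u. u \<in> uverts G - {r} \<Longrightarrow> f u \<in> nbrs G u \<and> d (f u) < d u"
proof -
  define d where "d u = (LEAST t. (u, r) \<in> uadj G ^^ t)" for u
  have "\<exists>v. v \<in> nbrs G u \<and> d v < d u" if u: "u \<in> uverts G - {r}" for u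
  proof -
    have "(u, r) \<in> (uadj G)\<^sup>*" using conn r u by (simp add: uconnected_def)
    then have "\<exists>t. (u, r) \<in> uadj G ^^ t" by (simp add: rtrancl_power)
    then have path: "(u, r) \<in> uadj G ^^ d u" unfolding d_def by (rule LeastI_ex)
    then obtain t where t: "d u = Suc t" using u by (cases "d u") auto
    then obtain v where v: "(u, v) \<in> uadj G" "(v, r) \<in> uadj G ^^ t"
      using path relpow_Suc_D2 by metis
    then have "d v \<le> t" unfolding d_def by (intro Least_le)
    then show ?thesis using v(1) t by (auto simp: nbrs_def uadj_def)
  qed
  then have "\<exists>f. \<forall>u\<in>uverts G - {r}. f u \<in> nbrs G u \<and> d (f u) < d u" by metis
  then show thesis using that by blast
qed

lemma rooted_forests_nonempty:
  assumes conn: "uconnected G" and S: "S \<subset> uverts G"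
  shows "rooted_forests G S \<noteq> {}"
proof -
  obtain r where r: "r \<in> uverts G" "r \<notin> S" using S by blast
  obtain d :: "'a \<Rightarrow> nat" and f
    where f: "\<And>u. u \<in> uverts G - {r} \<Longrightarrow> f u \<in> nbrs G u \<and> d (f u) < d u"
    using connected_parent_function[OF conn r(1)] by metis
  have "restrict f S \<in> PiE S (nbrs G)" using f S r by auto
  moreover have "grounded S (restrict f S)"
    unfolding grounded_def using f S r by (intro exI[of _ d]) auto
  ultimately show ?thesis unfolding rooted_forests_def by blast
qed

text \<open>
  A connected graph has at least one forest whose roots lie outside a given proper subset. This
  makes the interior block of a Laplacian invertible and also shows that there are spanning trees.
\<close>

lemma det_laplacian_nonzero:
  assumes G: "fin_simple_graph G" and conn: "uconnected G" and S: "S \<subset> uverts G"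
    and e: "bij_betw e {..<m} S"
  shows "det (mat m m (\<lambda>(i, j). laplacian_entry G (e i) (e j))) \<noteq> 0"
proof -
  have "finite S" using bij_betw_finite[OF e] by simp
  then have "finite (rooted_forests G S)"
    using finite_PiE_nbrs[OF G] by (auto simp: rooted_forests_def)
  then show ?thesis
    using rooted_forests_nonempty[OF conn S] by (simp add: det_laplacian_rooted_forests[OF G e])
qed

section \<open>The matrix-tree theorem\<close>

lemma sym_uadj: "sym (uadj G)"
  by (auto simp: sym_def uadj_def insert_commute)

lemma rtrancl_distinct_path:
  assumes "(a, b) \<in> R\<^sup>*"
  obtains xs where "xs \<noteq> []" "hd xs = a" "last xs = b" "distinct xs"
    "successively (\<lambda>x y. (x, y) \<in> R) xs"
proof -
  have "\<exists>xs. xs \<noteq> [] \<and> hd xs = a \<and> last xs = b \<and> distinct xs \<and> successively (\<lambda>x y. (x, y) \<in> R) xs"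
    using assms
  proof (induction rule: converse_rtrancl_induct)
    case base
    show ?case by (intro exI[of _ "[b]"]) simp
  next
    case (step a c)
    then obtain xs where xs: "xs \<noteq> []" "hd xs = c" "last xs = b" "distinct xs"
      "successively (\<lambda>x y. (x, y) \<in> R) xs" by blast
    show ?case
    proof (cases "a \<in> set xs")
      case True
      then obtain ys zs where "xs = ys @ a # zs" by (auto simp: in_set_conv_decomp)
      then show ?thesis using xs
        by (intro exI[of _ "a # zs"]) (auto simp: successively_append_iff)
    next
      case False
      then show ?thesis using xs step.hyps(1)
        by (intro exI[of _ "a # xs"]) (auto simp: successively_Cons)
    qed
  qed
  then show thesis using that by blast
qed

text \<open>
  The cycle consists of the edge and a path without repetitions in \<open>F\<close>, which has at least three
  vertices because the edge itself is missing from \<open>F\<close>.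
\<close>

lemma ucycle_if_redundant_edge:
  assumes ab: "{a, b} \<in> uedges T" "a \<noteq> b" "{a, b} \<notin> uedges F"
    and sub: "uedges F \<subseteq> uedges T" and path: "(a, b) \<in> (uadj F)\<^sup>*"
  shows "\<exists>vs. ucycle T vs"
proof -
  obtain xs where xs: "xs \<noteq> []" "hd xs = a" "last xs = b" "distinct xs"
    and adj: "successively (\<lambda>x y. (x, y) \<in> uadj F) xs"
    using rtrancl_distinct_path[OF path] .
  let ?n = "length xs"
  have edge: "{xs ! i, xs ! Suc i} \<in> uedges F" if "Suc i < ?n" for i
    using adj that by (auto simp: successively_conv_nth uadj_def)
  have ends: "xs ! 0 = a" "xs ! (?n - 1) = b"
    using xs by (auto simp: hd_conv_nth last_conv_nth)
  have "?n \<noteq> 0" using xs(1) by simp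
  moreover have "?n \<noteq> 1" using ends ab(2) by auto
  moreover have "?n \<noteq> 2"
  proof
    assume "?n = 2"
    then show False using edge[of 0] ends ab(3) by simp
  qed
  ultimately have "3 \<le> ?n" by linarith
  moreover have "{xs ! i, xs ! (Suc i mod ?n)} \<in> uedges T" if "i < ?n" for i
  proof (cases "Suc i = ?n")
    case True
    then have "i = ?n - 1" by simp
    then show ?thesis using True ends ab(1) by (simp add: insert_commute)
  next
    case False
    then show ?thesis using edge[of i] sub that by auto
  qed
  ultimately show ?thesis using xs(4) unfolding ucycle_def by blast
qed

text \<open>
  At a vertex of maximal rank on a cycle, both cycle edges must lead to the parent of that vertex,
  but its two neighbours on the cycle are distinct.
\<close>

lemma not_ucycle_parent_edges:
  fixes d :: "'a \<Rightarrow> nat"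
  assumes d: "\<And>u. u \<in> S \<Longrightarrow> d (f u) < d u"
    and edges: "uedges T = (\<lambda>u. {u, f u}) ` S"
  shows "\<not> ucycle T vs"
proof
  assume cyc: "ucycle T vs"
  let ?n = "length vs"
  have n: "3 \<le> ?n" and dist: "distinct vs"
    and edge: "\<And>i. i < ?n \<Longrightarrow> {vs ! i, vs ! (Suc i mod ?n)} \<in> uedges T"
    using cyc by (auto simp: ucycle_def)
  have "\<exists>i<?n. \<forall>j<?n. d (vs ! j) \<le> d (vs ! i)"
  proof -
    have "Max (d ` set vs) \<in> d ` set vs" using n by (intro Max_in) auto
    then obtain i where "i < ?n" "d (vs ! i) = Max (d ` set vs)"
      by (auto simp: in_set_conv_nth)
    then show ?thesis by (intro exI[of _ i]) auto
  qed
  then obtain i where i: "i < ?n" and max: "\<And>j. j < ?n \<Longrightarrow> d (vs ! j) \<le> d (vs ! i)" by blast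
  have parent: "vs ! j = f (vs ! i)" if "{vs ! i, vs ! j} \<in> uedges T" "j < ?n" for j
  proof -
    obtain u where u: "u \<in> S" "{vs ! i, vs ! j} = {u, f u}" using \<open>{vs ! i, vs ! j} \<in> uedges T\<close> edges by auto
    then consider "vs ! i = u" "vs ! j = f u" | "vs ! i = f u" "vs ! j = u"
      by (auto simp: doubleton_eq_iff)
    then show ?thesis
    proof cases
      case 2
      then show ?thesis using d[OF u(1)] max[OF that(2)] by simp
    qed simp
  qed
  \<comment> \<open>The positions of the predecessor and the successor of \<open>i\<close> on the cycle.\<close>
  define j where "j = (if i = 0 then ?n - 1 else i - 1)"
  define k where "k = (if Suc i = ?n then 0 else Suc i)"
  have jk: "j < ?n" "k < ?n" "j \<noteq> k" "Suc j mod ?n = i" "Suc i mod ?n = k"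
    using i n by (auto simp: j_def k_def)
  have "{vs ! i, vs ! j} \<in> uedges T" "{vs ! i, vs ! k} \<in> uedges T"
    using edge[OF jk(1)] edge[OF i] jk by (auto simp: insert_commute)
  then have "vs ! j = vs ! k" using parent jk by metis
  then show False using dist jk by (simp add: nth_eq_iff_index_eq)
qed

definition parent_graph :: "'a ugraph \<Rightarrow> 'a set \<Rightarrow> ('a \<Rightarrow> 'a) \<Rightarrow> 'a ugraph" where
  "parent_graph G S f = \<lparr>uverts = uverts G, uedges = (\<lambda>u. {u, f u}) ` S\<rparr>"

lemma grounded_rank:
  assumes "grounded S f"
  obtains d :: "'a \<Rightarrow> nat" where "\<And>u. u \<in> S \<Longrightarrow> d (f u) < d u"
proof -
  obtain d :: "'a \<Rightarrow> nat" where d: "\<And>u. u \<in> S \<Longrightarrow> f u \<in> S \<Longrightarrow> d (f u) < d u"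
    using assms unfolding grounded_def by blast
  \<comment> \<open>Outside \<open>S\<close> the given rank is arbitrary; resetting it to \<open>0\<close> makes it drop on leaving \<open>S\<close> too.\<close>
  show thesis by (rule that[of "\<lambda>u. if u \<in> S then Suc (d u) else 0"]) (use d in auto)
qed

lemma rooted_forest_rank:
  assumes "f \<in> rooted_forests G S"
  obtains d :: "'a \<Rightarrow> nat" where "\<And>u. u \<in> S \<Longrightarrow> d (f u) < d u"
proof -
  have "grounded S f" using assms by (simp add: rooted_forests_def)
  then show thesis by (rule grounded_rank) (rule that)
qed

lemma parent_graph_spanning_tree:
  assumes G: "simple_graph G" and r: "r \<in> uverts G"
    and f: "f \<in> rooted_forests G (uverts G - {r})"
  shows "uspanning_tree (parent_graph G (uverts G - {r}) f) G"
proof -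
  let ?S = "uverts G - {r}"
  let ?T = "parent_graph G ?S f"
  have nb: "f u \<in> nbrs G u" if "u \<in> ?S" for u
    using f that by (auto simp: rooted_forests_def)
  obtain d :: "'a \<Rightarrow> nat" where d: "\<And>u. u \<in> ?S \<Longrightarrow> d (f u) < d u"
    by (rule rooted_forest_rank[OF f]) (rule that)
  have V: "f u \<in> uverts G" "f u \<noteq> u" if "u \<in> ?S" for u
    using nb[OF that] nbrs_subset[OF G, of u] by auto
  have "card {u, f u} = 2" if "u \<in> ?S" for u
    using V(2)[OF that] by (simp add: card_insert_if)
  then have "simple_graph ?T"
    using V(1) by (simp add: simple_graph_def parent_graph_def)
  then have sub: "usubgraph ?T G"
    using nb by (auto simp: usubgraph_def parent_graph_def nbrs_def)
  have to_root: "(u, r) \<in> (uadj ?T)\<^sup>*" if "u \<in> uverts G" for u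
    using that
  proof (induction "d u" arbitrary: u rule: less_induct)
    case less
    show ?case
    proof (cases "u = r")
      case False
      then have u: "u \<in> ?S" using less.prems by simp
      have "(u, f u) \<in> uadj ?T" using u by (auto simp: uadj_def parent_graph_def)
      moreover have "(f u, r) \<in> (uadj ?T)\<^sup>*" using less.hyps d[OF u] V(1)[OF u] by blast
      ultimately show ?thesis by (rule converse_rtrancl_into_rtrancl)
    qed simp
  qed
  have "uconnected ?T"
    unfolding uconnected_def
  proof (intro conjI ballI)
    show "uverts ?T \<noteq> {}" using r by (auto simp: parent_graph_def)
    fix u v assume "u \<in> uverts ?T" "v \<in> uverts ?T"
    then have "(u, r) \<in> (uadj ?T)\<^sup>*" "(v, r) \<in> (uadj ?T)\<^sup>*"
      using to_root by (auto simp: parent_graph_def)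
    moreover have "sym ((uadj ?T)\<^sup>*)" by (intro sym_rtrancl sym_uadj)
    ultimately show "(u, v) \<in> (uadj ?T)\<^sup>*" by (meson rtrancl_trans symD)
  qed
  moreover have "\<not> ucycle ?T vs" for vs
    by (rule not_ucycle_parent_edges[of ?S d f, OF d]) (auto simp: parent_graph_def)
  ultimately show ?thesis
    using sub by (auto simp: uspanning_tree_def utree_def parent_graph_def)
qed

text \<open>
  By induction on the rank: in the graph of \<open>g\<close>, the edge from \<open>u\<close> to \<open>f u\<close> belongs to \<open>u\<close> or to \<open>f u\<close>.
  In the second case \<open>g\<close> sends \<open>f u\<close> back to \<open>u\<close>, and by induction so does \<open>f\<close>, which would raise
  the rank.
\<close>

lemma parent_graph_inj:
  assumes f: "f \<in> rooted_forests G (uverts G - {r})" and g: "g \<in> rooted_forests G (uverts G - {r})"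
    and G: "simple_graph G"
    and eq: "parent_graph G (uverts G - {r}) f = parent_graph G (uverts G - {r}) g"
  shows "f = g"
proof -
  let ?S = "uverts G - {r}"
  obtain d :: "'a \<Rightarrow> nat" where d: "\<And>u. u \<in> ?S \<Longrightarrow> d (f u) < d u"
    by (rule rooted_forest_rank[OF f]) (rule that)
  have "f u = g u" if "u \<in> ?S" for u
    using that
  proof (induction "d u" arbitrary: u rule: less_induct)
    case less
    have "{u, f u} \<in> (\<lambda>u. {u, g u}) ` ?S"
      using eq less.prems by (auto simp: parent_graph_def)
    then obtain w where w: "w \<in> ?S" "{u, f u} = {w, g w}" by auto
    then consider "w = u" "g w = f u" | "w = f u" "g w = u"
      by (auto simp: doubleton_eq_iff)
    then show ?case
    proof cases
      case 2
      then have "f w = u" using less.hyps[of w] d[OF less.prems] w(1) by simp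
      then show ?thesis using d[OF less.prems] d[OF w(1)] 2 by simp
    qed simp
  qed
  then show ?thesis
    using f g by (intro PiE_ext[of f ?S "nbrs G" g]) (auto simp: rooted_forests_def)
qed

text \<open>
  Orient the tree towards the root. The parent edges form a connected spanning subgraph, and an
  edge of the tree outside it would close a cycle.
\<close>

lemma parent_graph_surj:
  assumes G: "simple_graph G" and r: "r \<in> uverts G" and T: "uspanning_tree T G"
  shows "\<exists>f\<in>rooted_forests G (uverts G - {r}). parent_graph G (uverts G - {r}) f = T"
proof -
  let ?S = "uverts G - {r}"
  have V: "uverts T = uverts G" and sub: "uedges T \<subseteq> uedges G" and sT: "simple_graph T"
    and conn: "uconnected T" and acyc: "\<And>vs. \<not> ucycle T vs"
    using T by (auto simp: uspanning_tree_def usubgraph_def utree_def)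
  obtain d :: "'a \<Rightarrow> nat" and h
    where h: "\<And>u. u \<in> ?S \<Longrightarrow> h u \<in> nbrs T u \<and> d (h u) < d u"
    using connected_parent_function[OF conn, of r] r V by metis
  define f where "f = restrict h ?S"
  have f: "f u = h u" if "u \<in> ?S" for u using that by (simp add: f_def)
  have "h u \<in> nbrs G u" if "u \<in> ?S" for u using h[OF that] sub by (auto simp: nbrs_def)
  then have "f \<in> PiE ?S (nbrs G)" by (simp add: f_def)
  moreover have "grounded ?S f" unfolding grounded_def using h f by (intro exI[of _ d]) auto
  ultimately have forest: "f \<in> rooted_forests G ?S" by (simp add: rooted_forests_def)
  let ?F = "parent_graph G ?S f"
  have F_sub: "uedges ?F \<subseteq> uedges T" using h f by (auto simp: parent_graph_def nbrs_def)
  have F_conn: "uconnected ?F"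
    using parent_graph_spanning_tree[OF G r forest] by (simp add: uspanning_tree_def utree_def)
  have "uedges T \<subseteq> uedges ?F"
  proof (rule ccontr)
    assume "\<not> uedges T \<subseteq> uedges ?F"
    then obtain e where e: "e \<in> uedges T" "e \<notin> uedges ?F" by blast
    then have "card e = 2" "e \<subseteq> uverts G" using sT V by (auto simp: simple_graph_def)
    then obtain a b where ab: "e = {a, b}" "a \<noteq> b" "a \<in> uverts G" "b \<in> uverts G"
      by (auto simp: card_2_iff)
    then have "(a, b) \<in> (uadj ?F)\<^sup>*" using F_conn by (auto simp: uconnected_def parent_graph_def)
    then show False using ucycle_if_redundant_edge[OF _ ab(2) _ F_sub] e ab acyc by blast
  qed
  then have "?F = T" using F_sub V by (auto simp: parent_graph_def)
  then show ?thesis using forest by blast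
qed

lemma num_spanning_trees_rooted_forests:
  assumes "simple_graph G" "r \<in> uverts G"
  shows "num_spanning_trees G = card (rooted_forests G (uverts G - {r}))"
proof -
  have "bij_betw (parent_graph G (uverts G - {r})) (rooted_forests G (uverts G - {r})) {T. uspanning_tree T G}"
  proof (rule bij_betw_imageI)
    show "inj_on (parent_graph G (uverts G - {r})) (rooted_forests G (uverts G - {r}))"
      by (intro inj_onI) (rule parent_graph_inj[OF _ _ assms(1)])
    show "parent_graph G (uverts G - {r}) ` rooted_forests G (uverts G - {r}) = {T. uspanning_tree T G}"
      using parent_graph_spanning_tree[OF assms] parent_graph_surj[OF assms] by blast
  qed
  then show ?thesis unfolding num_spanning_trees_def by (rule bij_betw_same_card[symmetric])
qed

lemma matrix_tree:
  assumes G: "fin_simple_graph G" and r: "r \<in> uverts G"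
    and e: "bij_betw e {..<m} (uverts G - {r})"
  shows "det (mat m m (\<lambda>(i, j). laplacian_entry G (e i) (e j))) = real (num_spanning_trees G)"
proof -
  have "simple_graph G" using G by (simp add: fin_simple_graph_def)
  then show ?thesis
    by (simp only: num_spanning_trees_rooted_forests[OF _ r] det_laplacian_rooted_forests[OF G e])
qed

section \<open>Dirichlet-to-Neumann maps\<close>

lemma laplacian_entry_nbrs:
  assumes "simple_graph G"
  shows "laplacian_entry G u v =
    (if u = v then real (card (nbrs G u)) else if v \<in> nbrs G u then -1 else 0)"
  by (simp add: laplacian_entry_def udegree_nbrs[OF assms] nbrs_def)

lemma laplacian_entry_sym: "laplacian_entry G u v = laplacian_entry G v u"
  by (auto simp: laplacian_entry_def insert_commute)

lemma laplacian_row_sum: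
  assumes "fin_simple_graph G" "u \<in> uverts G"
  shows "(\<Sum>v\<in>uverts G. laplacian_entry G u v) = 0"
proof -
  have fin: "finite (uverts G)" and sub: "nbrs G u \<subseteq> uverts G"
    using assms nbrs_subset[of G u] by (auto simp: fin_simple_graph_def)
  have "(\<Sum>v\<in>uverts G. laplacian_entry G u v) =
      (\<Sum>w\<in>nbrs G u. \<Sum>v\<in>uverts G. (if u = v then 1 else 0) - (if w = v then 1 else 0))"
    unfolding laplacian_entry_sum_nbrs[OF assms(1)] by (rule sum.swap)
  also have "\<dots> = 0"
    using fin sub assms(2) by (intro sum.neutral) (auto simp: sum_subtractf)
  finally show ?thesis .
qed

lemma laplacian_block_carrier [simp]: "laplacian_block G S T \<in> carrier_mat (card S) (card T)"
  by (simp add: laplacian_block_def)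

lemma transpose_laplacian_block: "transpose_mat (laplacian_block G S T) = laplacian_block G T S"
  by (rule eq_matI) (auto simp: laplacian_block_def laplacian_entry_sym)

lemma laplacian_block_mult_ones:
  assumes "finite T"
  shows "laplacian_block G S T *\<^sub>v ones (card T) =
    vec (card S) (\<lambda>i. \<Sum>v\<in>T. laplacian_entry G (from_nat_into S i) v)"
proof (rule eq_vecI)
  fix i assume "i < dim_vec (vec (card S) (\<lambda>i. \<Sum>v\<in>T. laplacian_entry G (from_nat_into S i) v))"
  then have i: "i < card S" by simp
  have "(laplacian_block G S T *\<^sub>v ones (card T)) $ i
      = (\<Sum>j<card T. laplacian_entry G (from_nat_into S i) (from_nat_into T j))"
    using i by (auto simp: laplacian_block_def ones_def scalar_prod_def atLeast0LessThan intro!: sum.cong)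
  also have "\<dots> = (\<Sum>v\<in>T. laplacian_entry G (from_nat_into S i) v)"
    by (rule sum.reindex_bij_betw[OF bij_betw_from_nat_into_finite[OF assms]])
  finally show "(laplacian_block G S T *\<^sub>v ones (card T)) $ i =
      vec (card S) (\<lambda>i. \<Sum>v\<in>T. laplacian_entry G (from_nat_into S i) v) $ i"
    using i by simp
qed (simp add: laplacian_block_def)

text \<open>
  The rows of a Laplacian sum to zero. Splitting the columns into \<open>U\<close> and its complement makes this a
  relation between two blocks.
\<close>

lemma laplacian_block_row_sums:
  assumes G: "fin_simple_graph G" and U: "U \<subseteq> uverts G" and S: "S \<subseteq> uverts G"
  shows "laplacian_block G S (uverts G - U) *\<^sub>v ones (card (uverts G - U)) =
    - (laplacian_block G S U *\<^sub>v ones (card U))"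
proof -
  have fin: "finite (uverts G)" using G by (simp add: fin_simple_graph_def)
  have "(\<Sum>v\<in>uverts G - U. laplacian_entry G u v) = - (\<Sum>v\<in>U. laplacian_entry G u v)"
    if "u \<in> uverts G" for u
    using sum.subset_diff[OF U fin, of "laplacian_entry G u"] laplacian_row_sum[OF G that] by simp
  moreover have "from_nat_into S i \<in> uverts G" if "i < card S" for i
    using S that from_nat_into[of S i] by fastforce
  ultimately show ?thesis
    using fin U finite_subset[OF U fin]
    by (intro eq_vecI) (auto simp: laplacian_block_mult_ones)
qed

lemma laplacian_zero_line_sums:
  assumes "fin_simple_graph G"
  shows "laplacian G \<in> carrier_mat (card (uverts G)) (card (uverts G))"
    and "transpose_mat (laplacian G) = laplacian G"
    and "laplacian G *\<^sub>v ones (card (uverts G)) = 0\<^sub>v (card (uverts G))"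
proof -
  have "from_nat_into (uverts G) i \<in> uverts G" if "i < card (uverts G)" for i
    using that from_nat_into[of "uverts G" i] by fastforce
  then show "laplacian G *\<^sub>v ones (card (uverts G)) = 0\<^sub>v (card (uverts G))"
    using assms unfolding laplacian_def
    by (subst laplacian_block_mult_ones) (auto simp: fin_simple_graph_def laplacian_row_sum[OF assms])
qed (simp_all add: laplacian_def transpose_laplacian_block)

definition interior_block :: "'a ugraph \<Rightarrow> 'a ugraph \<Rightarrow> real mat" where
  "interior_block H Y = laplacian_block H (uverts H - uverts Y) (uverts H - uverts Y)"

definition boundary_block :: "'a ugraph \<Rightarrow> 'a ugraph \<Rightarrow> real mat" where
  "boundary_block H Y = laplacian_block H (uverts H - uverts Y) (uverts Y)"

text \<open>
  The one place where the optional result of \<^const>\<open>mat_inverse\<close> is resolved: the interior block is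
  invertible since the graph is connected and some vertex lies on the boundary.
\<close>

lemma interior_inverse:
  assumes H: "fin_simple_graph H" "uconnected H"
    and Y: "uverts Y \<noteq> {}" "uverts Y \<subseteq> uverts H"
  defines "m \<equiv> card (uverts H - uverts Y)"
  obtains W where "W \<in> carrier_mat m m" "interior_block H Y * W = 1\<^sub>m m" "W * interior_block H Y = 1\<^sub>m m"
    "transpose_mat W = W" "det (interior_block H Y) \<noteq> 0"
    "DN H Y = laplacian_block H (uverts Y) (uverts Y)
       - transpose_mat (boundary_block H Y) * W * boundary_block H Y"
proof -
  let ?I = "uverts H - uverts Y" and ?A = "interior_block H Y"
  have A: "?A \<in> carrier_mat m m" by (simp add: interior_block_def m_def)
  have "finite ?I" using H by (simp add: fin_simple_graph_def)
  then have e: "bij_betw (from_nat_into ?I) {..<m} ?I"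
    unfolding m_def by (rule bij_betw_from_nat_into_finite)
  have det: "det ?A \<noteq> 0"
    unfolding interior_block_def laplacian_block_def m_def[symmetric]
    using Y by (intro det_laplacian_nonzero[OF H _ e]) auto
  then obtain W where W: "mat_inverse ?A = Some W"
    using det_non_zero_imp_unit[OF A det, where b = "()"] mat_inverse(1)[OF A, where b = "()"]
    by (cases "mat_inverse ?A") auto
  have inv: "?A * W = 1\<^sub>m m" "W * ?A = 1\<^sub>m m" "W \<in> carrier_mat m m"
    using mat_inverse(2)[OF A W] by auto
  have At: "transpose_mat ?A = ?A" by (simp add: interior_block_def transpose_laplacian_block)
  have "transpose_mat W * ?A = 1\<^sub>m m"
    using transpose_mult[OF A inv(3)] At inv(1) by simp
  then have "transpose_mat W = W"
    using inv A assoc_mult_mat[of "transpose_mat W" m m ?A m W m] by simp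
  moreover have "DN H Y = laplacian_block H (uverts Y) (uverts Y)
      - transpose_mat (boundary_block H Y) * W * boundary_block H Y"
    using W by (simp add: DN_def Let_def interior_block_def boundary_block_def)
  ultimately show thesis using that inv det by blast
qed

lemma mult_mat_vec_uminus:
  fixes M :: "'a::ring mat"
  assumes "M \<in> carrier_mat m n" "v \<in> carrier_vec n"
  shows "M *\<^sub>v (- v) = - (M *\<^sub>v v)"
  using assms by (intro eq_vecI) auto

text \<open>
  With interior block \<open>A\<close> and boundary block \<open>B\<close>, the interior rows of the Laplacian give
  \<open>B 1 = - A 1\<close>, hence \<open>A\<^sup>-\<^sup>1 B 1 = - 1\<close>. Thus the Dirichlet-to-Neumann map sends the constant vector to
  \<open>D 1 + B\<^sup>T 1\<close>, which is zero by the boundary rows.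
\<close>

lemma DN_zero_line_sums:
  assumes H: "fin_simple_graph H" "uconnected H"
    and Y: "uverts Y \<noteq> {}" "uverts Y \<subseteq> uverts H"
  shows "DN H Y \<in> carrier_mat (card (uverts Y)) (card (uverts Y))"
    and "transpose_mat (DN H Y) = DN H Y"
    and "DN H Y *\<^sub>v ones (card (uverts Y)) = 0\<^sub>v (card (uverts Y))"
proof -
  let ?I = "uverts H - uverts Y" and ?U = "uverts Y"
  let ?m = "card ?I" and ?k = "card ?U"
  let ?A = "interior_block H Y" and ?B = "boundary_block H Y" and ?D = "laplacian_block H ?U ?U"
  obtain W where W: "W \<in> carrier_mat ?m ?m" "W * ?A = 1\<^sub>m ?m" "transpose_mat W = W"
    and DN: "DN H Y = ?D - transpose_mat ?B * W * ?B"
    using interior_inverse[OF H Y] by metis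
  have A: "?A \<in> carrier_mat ?m ?m" and B: "?B \<in> carrier_mat ?m ?k" and D: "?D \<in> carrier_mat ?k ?k"
    by (simp_all add: interior_block_def boundary_block_def)
  have Bt: "transpose_mat ?B \<in> carrier_mat ?k ?m" using B by simp
  have S: "transpose_mat ?B * W * ?B \<in> carrier_mat ?k ?k" using Bt B W(1) by simp
  show "DN H Y \<in> carrier_mat ?k ?k" unfolding DN by (rule minus_carrier_mat[OF S])
  have "transpose_mat (transpose_mat ?B * W * ?B) = transpose_mat ?B * (transpose_mat W * ?B)"
    unfolding transpose_mult[OF mult_carrier_mat[OF Bt W(1)] B] transpose_mult[OF Bt W(1)] by simp
  also have "\<dots> = transpose_mat ?B * W * ?B"
    unfolding W(3) by (rule assoc_mult_mat[OF Bt W(1) B, symmetric])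
  finally show "transpose_mat (DN H Y) = DN H Y"
    unfolding DN transpose_minus[OF D S] by (simp only: transpose_laplacian_block)
  have o: "ones ?k \<in> carrier_vec ?k" "ones ?m \<in> carrier_vec ?m" by (simp_all add: ones_def)
  have Bo: "?B *\<^sub>v ones ?k = - (?A *\<^sub>v ones ?m)"
    using laplacian_block_row_sums[OF H(1) Y(2), of ?I] by (simp add: interior_block_def boundary_block_def)
  have "W *\<^sub>v (?B *\<^sub>v ones ?k) = - (W *\<^sub>v (?A *\<^sub>v ones ?m))"
    unfolding Bo by (rule mult_mat_vec_uminus[OF W(1) mult_mat_vec_carrier[OF A o(2)]])
  also have "W *\<^sub>v (?A *\<^sub>v ones ?m) = ones ?m"
    unfolding assoc_mult_mat_vec[OF W(1) A o(2), symmetric] W(2) by (rule one_mult_mat_vec[OF o(2)])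
  finally have "W *\<^sub>v (?B *\<^sub>v ones ?k) = - ones ?m" .
  then have "transpose_mat ?B * W * ?B *\<^sub>v ones ?k = - (transpose_mat ?B *\<^sub>v ones ?m)"
    by (simp only: assoc_mult_mat_vec[OF mult_carrier_mat[OF Bt W(1)] B o(1)]
        assoc_mult_mat_vec[OF Bt W(1) mult_mat_vec_carrier[OF B o(1)]] mult_mat_vec_uminus[OF Bt o(2)])
  also have "\<dots> = ?D *\<^sub>v ones ?k"
    using laplacian_block_row_sums[OF H(1) Y(2), of ?U] Y(2)
    by (simp add: boundary_block_def transpose_laplacian_block)
  finally show "DN H Y *\<^sub>v ones ?k = 0\<^sub>v ?k"
    unfolding DN minus_mult_distrib_mat_vec[OF D S o(1)]
    using minus_cancel_vec[OF mult_mat_vec_carrier[OF D o(1)]] by simp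
qed

definition truncate_cols :: "'a mat \<Rightarrow> 'a mat" where
  "truncate_cols M = mat (dim_row M) (dim_col M - 1) (\<lambda>(i, j). M $$ (i, j))"

text \<open>
  Forming a Schur complement commutes with deleting a row and a column of the complementary block.
\<close>

lemma truncate_transpose_mult_mult:
  fixes B W :: "'a::comm_ring_1 mat"
  assumes "B \<in> carrier_mat m n" "W \<in> carrier_mat m m"
  shows "truncate_mat (transpose_mat B * W * B) = transpose_mat (truncate_cols B) * W * truncate_cols B"
proof (rule eq_matI)
  have B': "truncate_cols B \<in> carrier_mat m (n - 1)" using assms by (simp add: truncate_cols_def)
  fix i j
  assume "i < dim_row (transpose_mat (truncate_cols B) * W * truncate_cols B)"
    "j < dim_col (transpose_mat (truncate_cols B) * W * truncate_cols B)"
  then have ij: "i < n - 1" "j < n - 1" using B' by auto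
  have "truncate_mat (transpose_mat B * W * B) $$ (i, j) = (transpose_mat B * W * B) $$ (i, j)"
    using ij assms by (simp add: truncate_mat_def)
  then show "truncate_mat (transpose_mat B * W * B) $$ (i, j) =
      (transpose_mat (truncate_cols B) * W * truncate_cols B) $$ (i, j)"
    using ij assms transpose_mult_mult_index[OF assms, of i j] transpose_mult_mult_index[OF B' assms(2) ij]
    by (simp add: truncate_cols_def)
qed (use assms in \<open>auto simp: truncate_mat_def truncate_cols_def\<close>)

lemma truncate_minus:
  assumes "M \<in> carrier_mat n n" "N \<in> carrier_mat n n"
  shows "truncate_mat (M - N) = truncate_mat M - truncate_mat N"
  using assms by (intro eq_matI) (auto simp: truncate_mat_def)

definition append_enum :: "nat \<Rightarrow> (nat \<Rightarrow> 'a) \<Rightarrow> (nat \<Rightarrow> 'a) \<Rightarrow> nat \<Rightarrow> 'a" where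
  "append_enum m f g i = (if i < m then f i else g (i - m))"

lemma bij_betw_append_enum:
  assumes f: "bij_betw f {..<m} S" and g: "bij_betw g {..<n} T" and "S \<inter> T = {}"
  shows "bij_betw (append_enum m f g) {..<m + n} (S \<union> T)"
proof -
  have "bij_betw (append_enum m f g) {..<m} S"
    using f by (subst bij_betw_cong[of _ _ f]) (auto simp: append_enum_def)
  moreover have "bij_betw (append_enum m f g) {m..<m + n} T"
  proof -
    have "bij_betw (\<lambda>i. i - m) {m..<m + n} {..<n}"
      by (rule bij_betw_byWitness[of _ "\<lambda>i. i + m"]) auto
    then have "bij_betw (g \<circ> (\<lambda>i. i - m)) {m..<m + n} T" by (rule bij_betw_trans[OF _ g])
    then show ?thesis by (subst bij_betw_cong[of _ _ "g \<circ> (\<lambda>i. i - m)"]) (auto simp: append_enum_def)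
  qed
  ultimately have "bij_betw (append_enum m f g) ({..<m} \<union> {m..<m + n}) (S \<union> T)"
    using assms(3) by (rule bij_betw_combine)
  then show ?thesis by (simp add: ivl_disj_un)
qed

text \<open>
  The vertex that is removed from the Laplacian in the matrix-tree theorem is the last one in the
  fixed enumeration of \<open>U\<close>, so that its removal truncates matrices indexed by \<open>U\<close>.
\<close>

lemma bij_betw_from_nat_into_butlast:
  assumes "finite U" "card U = Suc q"
  shows "bij_betw (from_nat_into U) {..<q} (U - {from_nat_into U q})"
    and "from_nat_into U q \<in> U"
proof -
  have b: "bij_betw (from_nat_into U) {..<Suc q} U"
    using bij_betw_from_nat_into_finite[OF assms(1)] assms(2) by simp
  then show "from_nat_into U q \<in> U" by (auto simp: bij_betw_def)
  show "bij_betw (from_nat_into U) {..<q} (U - {from_nat_into U q})"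
    using b by (auto simp: bij_betw_def inj_on_def lessThan_Suc)
qed

text \<open>
  List the interior vertices first and remove the last boundary vertex. The matrix-tree theorem
  evaluates the determinant of the remaining Laplacian, and eliminating the interior block
  factors it.
\<close>

lemma det_truncate_DN:
  assumes H: "fin_simple_graph H" "uconnected H"
    and Y: "uverts Y \<noteq> {}" "uverts Y \<subseteq> uverts H"
  shows "det (interior_block H Y) * det (truncate_mat (DN H Y)) = real (num_spanning_trees H)"
proof -
  let ?I = "uverts H - uverts Y" and ?U = "uverts Y"
  define m where "m = card ?I"
  have finH: "finite (uverts H)" using H by (simp add: fin_simple_graph_def)
  then have finU: "finite ?U" using Y finite_subset by blast
  then obtain q where q: "card ?U = Suc q" using Y(1) by (cases "card ?U") auto
  let ?A = "interior_block H Y" and ?B = "boundary_block H Y" and ?D = "laplacian_block H ?U ?U"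
  obtain W where W: "W \<in> carrier_mat m m" "?A * W = 1\<^sub>m m"
    and DN: "DN H Y = ?D - transpose_mat ?B * W * ?B"
    using interior_inverse[OF H Y] unfolding m_def by metis
  have A: "?A \<in> carrier_mat m m" and B: "?B \<in> carrier_mat m (Suc q)"
    and D: "?D \<in> carrier_mat (Suc q) (Suc q)"
    using q laplacian_block_carrier[of H ?I ?U] laplacian_block_carrier[of H ?U ?U]
    by (simp_all add: interior_block_def boundary_block_def m_def)
  define B' where "B' = truncate_cols ?B"
  define D' where "D' = truncate_mat ?D"
  have B': "B' \<in> carrier_mat m q" and D': "D' \<in> carrier_mat q q"
    using B D by (simp_all add: B'_def D'_def truncate_cols_def truncate_mat_def)
  define y where "y = from_nat_into ?U q"
  define e where "e = append_enum m (from_nat_into ?I) (from_nat_into ?U)"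
  have "bij_betw e {..<m + q} (?I \<union> (?U - {y}))"
    unfolding e_def y_def m_def
    by (intro bij_betw_append_enum bij_betw_from_nat_into_finite bij_betw_from_nat_into_butlast q finU)
      (use finH in auto)
  moreover have y: "y \<in> ?U" unfolding y_def by (rule bij_betw_from_nat_into_butlast(2)[OF finU q])
  then have "?I \<union> (?U - {y}) = uverts H - {y}" using Y(2) by auto
  ultimately have e: "bij_betw e {..<m + q} (uverts H - {y})" by simp
  have "mat (m + q) (m + q) (\<lambda>(i, j). laplacian_entry H (e i) (e j))
      = four_block_mat ?A B' (transpose_mat B') D'"
    using q A B' D' B D
    by (intro eq_matI)
      (auto simp: interior_block_def boundary_block_def B'_def D'_def laplacian_block_def m_def e_def
        append_enum_def truncate_cols_def truncate_mat_def laplacian_entry_sym)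
  then have "real (num_spanning_trees H) = det (four_block_mat ?A B' (transpose_mat B') D')"
    using matrix_tree[OF H(1) _ e] y Y(2) by auto
  also have "\<dots> = det ?A * det (D' - transpose_mat B' * W * B')"
    using A W B' D' by (intro det_schur_complement) auto
  also have "D' - transpose_mat B' * W * B' = truncate_mat (DN H Y)"
    unfolding DN B'_def D'_def truncate_transpose_mult_mult[OF B W(1), symmetric]
    using B W D by (intro truncate_minus[symmetric, of _ "Suc q"]) auto
  finally show ?thesis by simp
qed

lemma num_spanning_trees_nonzero:
  assumes G: "fin_simple_graph G" "uconnected G"
  shows "num_spanning_trees G \<noteq> 0"
proof -
  obtain r where r: "r \<in> uverts G" using G by (auto simp: uconnected_def)
  have "finite (uverts G - {r})" using G by (simp add: fin_simple_graph_def)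
  from bij_betw_from_nat_into_finite[OF this] show ?thesis
    using det_laplacian_nonzero[OF G, of "uverts G - {r}"] matrix_tree[OF G(1) r] r by fastforce
qed

lemma pseudo_det_DN:
  assumes H: "fin_simple_graph H" "uconnected H"
    and Y: "uverts Y \<noteq> {}" "uverts Y \<subseteq> uverts H"
  shows "of_real (det (interior_block H Y)) * pseudo_det (DN H Y) =
    of_nat (card (uverts Y)) * of_nat (num_spanning_trees H)"
proof -
  have "finite (uverts Y)" using H Y finite_subset by (auto simp: fin_simple_graph_def)
  then obtain q where q: "card (uverts Y) = Suc q" using Y(1) by (cases "card (uverts Y)") auto
  note tau = det_truncate_DN[OF H Y]
  have "det (truncate_mat (DN H Y)) \<noteq> 0"
    using tau num_spanning_trees_nonzero[OF H] by auto
  then have "pseudo_det (DN H Y) = of_real (of_nat (Suc q) * det (truncate_mat (DN H Y)))"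
    using DN_zero_line_sums[OF H Y] unfolding q by (intro pseudo_det_zero_line_sums)
  then have "of_real (det (interior_block H Y)) * pseudo_det (DN H Y) =
      of_real (of_nat (Suc q) * (det (interior_block H Y) * det (truncate_mat (DN H Y))))"
    by (simp add: mult_ac)
  also have "\<dots> = of_nat (Suc q) * of_nat (num_spanning_trees H)"
    unfolding tau by (simp del: of_nat_Suc)
  finally show ?thesis unfolding q .
qed

section \<open>Gluing two graphs\<close>

text \<open>
  The embedding of the right graph into the glued graph; the left one is embedded by \<^const>\<open>Inl\<close>.
\<close>

definition glue_right :: "'a ugraph \<Rightarrow> 'a \<Rightarrow> 'a + 'a" where
  "glue_right Y v = identify_copies Y (Inr v)"

lemma glue_right_simps [simp]:
  "v \<in> uverts Y \<Longrightarrow> glue_right Y v = Inl v"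
  "v \<notin> uverts Y \<Longrightarrow> glue_right Y v = Inr v"
  by (simp_all add: glue_right_def)

lemma inj_glue_right: "inj (glue_right Y)"
proof (rule injI)
  fix v w assume "glue_right Y v = glue_right Y w"
  then show "v = w" by (cases "v \<in> uverts Y"; cases "w \<in> uverts Y") simp_all
qed

lemma uedges_glue: "uedges (glue G1 Y G2) = (`) Inl ` uedges G1 \<union> (`) (glue_right Y) ` uedges G2"
proof -
  have "identify_copies Y ` Inl ` e = Inl ` e" for e by (simp add: image_image)
  moreover have "identify_copies Y ` Inr ` e = glue_right Y ` e" for e
    by (simp add: glue_right_def image_image)
  moreover have "uedges (glue G1 Y G2) = (\<lambda>e. identify_copies Y ` Inl ` e) ` uedges G1
      \<union> (\<lambda>e. identify_copies Y ` Inr ` e) ` uedges G2"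
    unfolding glue_def map_ugraph_def disjoint_union_def ugraph.simps image_Un
    unfolding image_image[of "(`) (identify_copies Y)"] ..
  ultimately show ?thesis by (simp only:)
qed

lemma uverts_glue:
  assumes "uverts Y \<subseteq> uverts G1"
  shows "uverts (glue G1 Y G2) = Inl ` uverts G1 \<union> Inr ` (uverts G2 - uverts Y)"
proof -
  have "uverts (glue G1 Y G2) = Inl ` uverts G1 \<union> glue_right Y ` uverts G2"
    unfolding glue_def map_ugraph_def disjoint_union_def ugraph.simps Plus_def image_Un image_image
      glue_right_def identify_copies.simps(1) ..
  also have "uverts G2 = (uverts G2 \<inter> uverts Y) \<union> (uverts G2 - uverts Y)" by blast
  finally have "uverts (glue G1 Y G2) = Inl ` uverts G1 \<union>
      (glue_right Y ` (uverts G2 \<inter> uverts Y) \<union> glue_right Y ` (uverts G2 - uverts Y))"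
    unfolding image_Un .
  moreover have "glue_right Y ` (uverts G2 \<inter> uverts Y) = Inl ` (uverts G2 \<inter> uverts Y)"
    "glue_right Y ` (uverts G2 - uverts Y) = Inr ` (uverts G2 - uverts Y)"
    by (rule image_cong[OF refl], simp)+
  moreover have "Inl ` uverts G1 \<union> Inl ` (uverts G2 \<inter> uverts Y) = (Inl ` uverts G1 :: ('a + 'a) set)"
    using assms by blast
  ultimately show ?thesis by (simp only: Un_assoc[symmetric])
qed

lemma full_subgraph_nbrs:
  assumes "full_subgraph Y G" "y \<in> uverts Y"
  shows "nbrs Y y = nbrs G y \<inter> uverts Y"
proof -
  have Y: "simple_graph Y" "uedges Y \<subseteq> uedges G"
    and full: "\<forall>v\<in>uverts Y. {y, v} \<in> uedges G \<longrightarrow> {y, v} \<in> uedges Y"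
    using assms unfolding full_subgraph_def usubgraph_def by blast+
  show ?thesis
  proof (intro equalityI subsetI)
    fix v assume "v \<in> nbrs Y y"
    then show "v \<in> nbrs G y \<inter> uverts Y"
      using Y(2) nbrs_subset[OF Y(1), of y] unfolding nbrs_def by blast
  next
    fix v assume "v \<in> nbrs G y \<inter> uverts Y"
    then show "v \<in> nbrs Y y" using full unfolding nbrs_def by blast
  qed
qed

locale gluing =
  fixes G1 G2 Y :: "'a ugraph"
  assumes G1: "fin_simple_graph G1" "uconnected G1"
    and G2: "fin_simple_graph G2" "uconnected G2"
    and Y_nonempty: "uverts Y \<noteq> {}"
    and full: "full_subgraph Y G1" "full_subgraph Y G2"
begin

abbreviation "G \<equiv> glue G1 Y G2"

lemma simple: "simple_graph G1" "simple_graph G2" "simple_graph Y"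
  and finite_verts: "finite (uverts G1)" "finite (uverts G2)" "finite (uverts Y)"
  and Y_sub: "uverts Y \<subseteq> uverts G1" "uverts Y \<subseteq> uverts G2"
  using G1 G2 full finite_subset[of "uverts Y" "uverts G1"]
  by (auto simp: fin_simple_graph_def full_subgraph_def usubgraph_def)

lemma fin_simple_Y: "fin_simple_graph Y"
  using simple finite_verts by (simp add: fin_simple_graph_def)

lemma glue_right_verts: "v \<in> uverts G2 \<Longrightarrow> glue_right Y v \<in> uverts G"
  using Y_sub by (cases "v \<in> uverts Y") (auto simp: uverts_glue[OF Y_sub(1)])

lemma fin_simple_G: "fin_simple_graph G"
proof -
  have "e \<subseteq> uverts G \<and> card e = 2" if "e \<in> uedges G" for e
    using that unfolding uedges_glue
  proof (elim UnE imageE)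
    fix f assume f: "e = Inl ` f" "f \<in> uedges G1"
    then have "f \<subseteq> uverts G1" "card f = 2" using simple by (auto simp: simple_graph_def)
    then show ?thesis unfolding f(1) by (auto simp: card_image uverts_glue[OF Y_sub(1)])
  next
    fix f assume f: "e = glue_right Y ` f" "f \<in> uedges G2"
    then have "f \<subseteq> uverts G2" "card f = 2" using simple by (auto simp: simple_graph_def)
    then show ?thesis unfolding f(1)
      using glue_right_verts by (auto simp: card_image inj_on_subset[OF inj_glue_right])
  qed
  then show ?thesis
    using finite_verts by (auto simp: fin_simple_graph_def simple_graph_def uverts_glue[OF Y_sub(1)])
qed

lemma uadj_glue:
  "uadj G = map_prod Inl Inl ` uadj G1 \<union> map_prod (glue_right Y) (glue_right Y) ` uadj G2"
proof -
  have "{p, q} \<in> (`) h ` uedges H \<longleftrightarrow> (p, q) \<in> map_prod h h ` uadj H"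
    if H: "simple_graph H" for p q H and h :: "'a \<Rightarrow> 'a + 'a"
  proof
    assume "{p, q} \<in> (`) h ` uedges H"
    then obtain f where f: "{p, q} = h ` f" "f \<in> uedges H" by blast
    then have "card f = 2" using H by (simp add: simple_graph_def)
    then obtain a b where ab: "f = {a, b}" by (auto simp: card_2_iff)
    then consider "p = h a" "q = h b" | "p = h b" "q = h a"
      using f(1) by (auto simp: doubleton_eq_iff)
    moreover have "(a, b) \<in> uadj H" "(b, a) \<in> uadj H"
      using f(2) ab by (simp_all add: uadj_def insert_commute)
    ultimately show "(p, q) \<in> map_prod h h ` uadj H"
      by cases force+
  next
    assume "(p, q) \<in> map_prod h h ` uadj H"
    then obtain a b where "p = h a" "q = h b" "{a, b} \<in> uedges H" by (auto simp: uadj_def)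
    then show "{p, q} \<in> (`) h ` uedges H" by (intro image_eqI[of _ _ "{a, b}"]) simp_all
  qed
  then have "{p, q} \<in> uedges G \<longleftrightarrow> (p, q) \<in> map_prod Inl Inl ` uadj G1
      \<union> map_prod (glue_right Y) (glue_right Y) ` uadj G2" for p q
    using simple by (simp only: uedges_glue Un_iff)
  then show ?thesis unfolding uadj_def[of G] by blast
qed

lemma nbrs_uadj: "v \<in> nbrs H u \<longleftrightarrow> (u, v) \<in> uadj H"
  by (simp add: nbrs_def uadj_def)

lemma nbrs_glue:
  "nbrs G p = {Inl b |a b. p = Inl a \<and> b \<in> nbrs G1 a}
    \<union> {glue_right Y b |a b. p = glue_right Y a \<and> b \<in> nbrs G2 a}"
  unfolding set_eq_iff nbrs_uadj uadj_glue Un_iff mem_Collect_eq image_iff Bex_def split_paired_Ex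
    map_prod_simp prod.inject by blast

lemma nbrs_glue_Inl:
  "nbrs G (Inl u) = Inl ` nbrs G1 u \<union> (if u \<in> uverts Y then glue_right Y ` nbrs G2 u else {})"
proof -
  have "Inl u = glue_right Y w \<longleftrightarrow> w = u \<and> u \<in> uverts Y" for w
    by (cases "w \<in> uverts Y") auto
  then show ?thesis unfolding nbrs_glue by auto
qed

lemma nbrs_glue_Inr:
  assumes "u \<notin> uverts Y"
  shows "nbrs G (Inr u) = glue_right Y ` nbrs G2 u"
proof -
  have "Inr u = glue_right Y w \<longleftrightarrow> w = u" for w
    using assms by (cases "w \<in> uverts Y") auto
  then show ?thesis unfolding nbrs_glue by auto
qed

lemma uconnected_G: "uconnected G"
proof -
  obtain r where r: "r \<in> uverts Y" using Y_nonempty by blast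
  have lift: "(h a, h b) \<in> (uadj G)\<^sup>*"
    if "(a, b) \<in> (uadj H)\<^sup>*" "map_prod h h ` uadj H \<subseteq> uadj G" for a b H and h :: "'a \<Rightarrow> 'a + 'a"
    using that(1)
  proof induction
    case (step b c)
    then have "(h b, h c) \<in> uadj G" using that(2) by (force simp: image_subset_iff)
    then show ?case using step.IH by (rule rtrancl_into_rtrancl[rotated])
  qed simp
  have to_r: "(x, Inl r) \<in> (uadj G)\<^sup>*" if x: "x \<in> uverts G" for x
  proof -
    consider a where "a \<in> uverts G1" "x = Inl a" | a where "a \<in> uverts G2" "a \<notin> uverts Y" "x = Inr a"
      using x by (auto simp: uverts_glue[OF Y_sub(1)])
    then show ?thesis
    proof cases
      case 1
      then have "(a, r) \<in> (uadj G1)\<^sup>*" using G1 r Y_sub by (auto simp: uconnected_def)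
      then show ?thesis unfolding 1(2) by (rule lift) (simp add: uadj_glue)
    next
      case 2
      then have "(a, r) \<in> (uadj G2)\<^sup>*" using G2 r Y_sub by (auto simp: uconnected_def)
      then have "(glue_right Y a, glue_right Y r) \<in> (uadj G)\<^sup>*" by (rule lift) (simp add: uadj_glue)
      then show ?thesis using 2 r by simp
    qed
  qed
  have "sym ((uadj G)\<^sup>*)" by (intro sym_rtrancl sym_uadj)
  then have "(x, y) \<in> (uadj G)\<^sup>*" if "x \<in> uverts G" "y \<in> uverts G" for x y
    using to_r[OF that(1)] to_r[OF that(2)] by (meson rtrancl_trans symD)
  moreover have "uverts G \<noteq> {}" using r Y_sub by (auto simp: uverts_glue[OF Y_sub(1)])
  ultimately show ?thesis by (auto simp: uconnected_def)
qed

lemmas simple_G = fin_simple_G[unfolded fin_simple_graph_def, THEN conjunct1]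

lemma laplacian_interior1:
  assumes "u \<notin> uverts Y"
  shows "laplacian_entry G (Inl u) (Inl v) = laplacian_entry G1 u v"
  using assms by (auto simp: laplacian_entry_nbrs simple simple_G nbrs_glue_Inl card_image)

lemma laplacian_interior12:
  assumes "u \<notin> uverts Y"
  shows "laplacian_entry G (Inl u) (Inr v) = 0"
  using assms by (auto simp: laplacian_entry_nbrs simple simple_G nbrs_glue_Inl)

lemma laplacian_interior2:
  assumes "u \<notin> uverts Y"
  shows "laplacian_entry G (Inr u) (glue_right Y v) = laplacian_entry G2 u v"
proof -
  have "Inr u = glue_right Y v \<longleftrightarrow> u = v" using assms by (cases "v \<in> uverts Y") auto
  moreover have "glue_right Y v \<in> glue_right Y ` S \<longleftrightarrow> v \<in> S" for S
    by (rule inj_image_mem_iff[OF inj_glue_right])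
  ultimately show ?thesis
    using card_image[OF inj_on_subset[OF inj_glue_right subset_UNIV], of Y "nbrs G2 u"]
    using assms by (cases "u = v") (simp_all add: laplacian_entry_nbrs simple simple_G nbrs_glue_Inr)
qed

text \<open>
  Between vertices of \<open>Y\<close> both graphs contribute, and what they share is counted twice. The common
  neighbours of a vertex of \<open>Y\<close> are exactly its neighbours in \<open>Y\<close>, because \<open>Y\<close> is full in both graphs.
  This is where the summand \<open>- L(Y)\<close> comes from.
\<close>

lemma laplacian_boundary:
  assumes u: "u \<in> uverts Y" and v: "v \<in> uverts Y"
  shows "laplacian_entry G (Inl u) (Inl v) =
    laplacian_entry G1 u v + laplacian_entry G2 u v - laplacian_entry Y u v"
proof -
  have fin: "finite (nbrs G1 u)" "finite (nbrs G2 u)" by (rule finite_nbrs[OF G1(1)], rule finite_nbrs[OF G2(1)])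
  have inj: "inj_on (glue_right Y) S" for S by (rule inj_on_subset[OF inj_glue_right subset_UNIV])
  have N: "nbrs G (Inl u) = Inl ` nbrs G1 u \<union> glue_right Y ` nbrs G2 u"
    using u by (simp add: nbrs_glue_Inl)
  have Y1: "nbrs Y u = nbrs G1 u \<inter> uverts Y" and Y2: "nbrs Y u = nbrs G2 u \<inter> uverts Y"
    by (rule full_subgraph_nbrs[OF full(1) u], rule full_subgraph_nbrs[OF full(2) u])
  have I: "Inl ` nbrs G1 u \<inter> glue_right Y ` nbrs G2 u = Inl ` nbrs Y u"
  proof (intro equalityI subsetI)
    fix x assume "x \<in> Inl ` nbrs G1 u \<inter> glue_right Y ` nbrs G2 u"
    then obtain w w' where w: "w \<in> nbrs G1 u" "x = Inl w" "w' \<in> nbrs G2 u" "x = glue_right Y w'" by auto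
    then have "w' \<in> uverts Y" by (cases "w' \<in> uverts Y") auto
    then show "x \<in> Inl ` nbrs Y u" using w Y2 by auto
  next
    fix x :: "'a + 'a" assume "x \<in> Inl ` nbrs Y u"
    then obtain w where w: "x = Inl w" "w \<in> nbrs Y u" by auto
    then have "w \<in> nbrs G1 u" "w \<in> nbrs G2 u" "w \<in> uverts Y" using Y1 Y2 by auto
    then show "x \<in> Inl ` nbrs G1 u \<inter> glue_right Y ` nbrs G2 u"
      using w(1) image_eqI[of x "glue_right Y" w] by simp
  qed
  have "card (nbrs G1 u) + card (nbrs G2 u) = card (nbrs G (Inl u)) + card (nbrs Y u)"
    using card_Un_Int[of "Inl ` nbrs G1 u" "glue_right Y ` nbrs G2 u"] fin
    unfolding I N[symmetric] by (simp add: card_image inj)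
  then have "real (card (nbrs G (Inl u))) = real (card (nbrs G1 u)) + real (card (nbrs G2 u)) - real (card (nbrs Y u))"
    by linarith
  moreover have "Inl v \<in> nbrs G (Inl u) \<longleftrightarrow> v \<in> nbrs Y u"
  proof -
    have "Inl v \<in> glue_right Y ` nbrs G2 u \<longleftrightarrow> v \<in> nbrs G2 u"
      using inj_image_mem_iff[OF inj_glue_right, of Y v] v by simp
    then show ?thesis using N Y1 Y2 v by auto
  qed
  moreover have "v \<in> nbrs G1 u \<longleftrightarrow> v \<in> nbrs Y u" "v \<in> nbrs G2 u \<longleftrightarrow> v \<in> nbrs Y u"
    using Y1 Y2 v by auto
  ultimately show ?thesis
    by (cases "u = v") (simp_all add: laplacian_entry_nbrs simple simple_G)
qed

lemma DN_glue_zero_line_sums: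
  defines "k \<equiv> card (uverts Y)"
  shows "DN_glue G1 Y G2 \<in> carrier_mat k k"
    and "transpose_mat (DN_glue G1 Y G2) = DN_glue G1 Y G2"
    and "DN_glue G1 Y G2 *\<^sub>v ones k = 0\<^sub>v k"
proof -
  note 1 = DN_zero_line_sums[OF G1 Y_nonempty Y_sub(1), folded k_def]
  note 2 = DN_zero_line_sums[OF G2 Y_nonempty Y_sub(2), folded k_def]
  note 3 = laplacian_zero_line_sums[OF fin_simple_Y, folded k_def]
  have 12: "DN G1 Y + DN G2 Y \<in> carrier_mat k k" using 1 2 by simp
  have o: "ones k \<in> carrier_vec k" by (simp add: ones_def)
  show "DN_glue G1 Y G2 \<in> carrier_mat k k" unfolding DN_glue_def using 3 by (intro minus_carrier_mat)
  show "transpose_mat (DN_glue G1 Y G2) = DN_glue G1 Y G2"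
    unfolding DN_glue_def transpose_minus[OF 12 3(1)] transpose_add[OF 1(1) 2(1)] 1(2) 2(2) 3(2) ..
  show "DN_glue G1 Y G2 *\<^sub>v ones k = 0\<^sub>v k"
    unfolding DN_glue_def minus_mult_distrib_mat_vec[OF 12 3(1) o]
      add_mult_distrib_mat_vec[OF 1(1) 2(1) o] 1(3) 2(3) 3(3) by simp
qed

text \<open>
  No edge joins the two interiors. The left interior comes first, then the right interior, then \<open>Y\<close>
  without its last vertex; the two interiors are eliminated one after the other. Eliminating the
  left one changes only the block on \<open>Y\<close>.
\<close>

lemma det_truncate_DN_glue:
  "det (interior_block G1 Y) * det (interior_block G2 Y) * det (truncate_mat (DN_glue G1 Y G2)) =
    real (num_spanning_trees G)"
proof -
  let ?I1 = "uverts G1 - uverts Y" and ?I2 = "uverts G2 - uverts Y" and ?U = "uverts Y"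
  define m1 m2 where "m1 = card ?I1" and "m2 = card ?I2"
  obtain q where q: "card ?U = Suc q" using Y_nonempty finite_verts by (cases "card ?U") auto
  let ?A1 = "interior_block G1 Y" and ?B1 = "boundary_block G1 Y" and ?D1 = "laplacian_block G1 ?U ?U"
  let ?A2 = "interior_block G2 Y" and ?B2 = "boundary_block G2 Y" and ?D2 = "laplacian_block G2 ?U ?U"
  obtain W1 where W1: "W1 \<in> carrier_mat m1 m1" "?A1 * W1 = 1\<^sub>m m1"
    and DN1: "DN G1 Y = ?D1 - transpose_mat ?B1 * W1 * ?B1"
    using interior_inverse[OF G1 Y_nonempty Y_sub(1)] unfolding m1_def by metis
  obtain W2 where W2: "W2 \<in> carrier_mat m2 m2" "?A2 * W2 = 1\<^sub>m m2"
    and DN2: "DN G2 Y = ?D2 - transpose_mat ?B2 * W2 * ?B2"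
    using interior_inverse[OF G2 Y_nonempty Y_sub(2)] unfolding m2_def by metis
  have A1: "?A1 \<in> carrier_mat m1 m1" and A2: "?A2 \<in> carrier_mat m2 m2"
    and B1: "?B1 \<in> carrier_mat m1 (Suc q)" and B2: "?B2 \<in> carrier_mat m2 (Suc q)"
    and D1: "?D1 \<in> carrier_mat (Suc q) (Suc q)" and D2: "?D2 \<in> carrier_mat (Suc q) (Suc q)"
    and L: "laplacian Y \<in> carrier_mat (Suc q) (Suc q)"
    using q laplacian_block_carrier[of _ ?I1 ?U] laplacian_block_carrier[of _ ?I2 ?U]
      laplacian_block_carrier[of _ ?U ?U]
    by (simp_all add: interior_block_def boundary_block_def m1_def m2_def laplacian_def)
  define C1 C2 where "C1 = truncate_cols ?B1" and "C2 = truncate_cols ?B2"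
  define E where "E = truncate_mat (?D1 + ?D2 - laplacian Y)"
  have C1: "C1 \<in> carrier_mat m1 q" and C2: "C2 \<in> carrier_mat m2 q" and E: "E \<in> carrier_mat q q"
    using B1 B2 D1 D2 L by (simp_all add: C1_def C2_def E_def truncate_cols_def truncate_mat_def)
  \<comment> \<open>The rows of the left interior: zero towards the right interior, then the block towards \<open>Y\<close>.\<close>
  define X where "X = mat m1 (m2 + q) (\<lambda>(i, j). if j < m2 then 0 else C1 $$ (i, j - m2))"
  have X: "X \<in> carrier_mat m1 (m2 + q)" by (simp add: X_def)
  \<comment> \<open>The part of the Laplacian on the right interior and \<open>Y\<close>.\<close>
  define Z where "Z = four_block_mat ?A2 C2 (transpose_mat C2) E"
  have Z: "Z \<in> carrier_mat (m2 + q) (m2 + q)" using A2 E by (simp add: Z_def)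
  define y where "y = from_nat_into ?U q"
  have y: "y \<in> ?U" unfolding y_def by (rule bij_betw_from_nat_into_butlast(2)[OF finite_verts(3) q])
  define e2 where "e2 = append_enum m2 (Inr \<circ> from_nat_into ?I2) (Inl \<circ> from_nat_into ?U)"
  define e where "e = append_enum m1 (Inl \<circ> from_nat_into ?I1) e2"
  have bij_comp: "bij_betw (h \<circ> g) {..<n} (h ` S)" if "bij_betw g {..<n} S" "inj h"
    for h :: "'a \<Rightarrow> 'a + 'a" and g n S
    using that by (intro bij_betw_trans[OF that(1)] inj_on_imp_bij_betw inj_on_subset[OF that(2)]) auto
  have "bij_betw e2 {..<m2 + q} (Inr ` ?I2 \<union> Inl ` (?U - {y}))"
    unfolding e2_def y_def m2_def
    by (intro bij_betw_append_enum bij_comp bij_betw_from_nat_into_finite bij_betw_from_nat_into_butlast q)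
      (use finite_verts in auto)
  then have "bij_betw e {..<m1 + (m2 + q)} (Inl ` ?I1 \<union> (Inr ` ?I2 \<union> Inl ` (?U - {y})))"
    unfolding e_def m1_def
    by (intro bij_betw_append_enum bij_comp bij_betw_from_nat_into_finite)
      (use finite_verts in auto)
  moreover have "Inl ` ?I1 \<union> (Inr ` ?I2 \<union> Inl ` (?U - {y})) = uverts G - {Inl y}"
    using y Y_sub by (auto simp: uverts_glue[OF Y_sub(1)])
  ultimately have e: "bij_betw e {..<m1 + (m2 + q)} (uverts G - {Inl y})" by simp
  have mem1: "from_nat_into ?I1 i \<in> ?I1" if "i < m1" for i
    using that from_nat_into[of ?I1 i] unfolding m1_def by fastforce
  have mem2: "from_nat_into ?I2 i \<in> ?I2" if "i < m2" for i
    using that from_nat_into[of ?I2 i] unfolding m2_def by fastforce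
  have memU: "from_nat_into ?U i \<in> ?U" for i
    using from_nat_into[of ?U i] Y_nonempty by blast
  have mid: "mat (m2 + q) (m2 + q) (\<lambda>(i, j). laplacian_entry G (e2 i) (e2 j)) = Z"
  proof -
    have 1: "laplacian_entry G (Inr u) (Inr v) = laplacian_entry G2 u v"
      if "u \<notin> ?U" "v \<notin> ?U" for u v using laplacian_interior2[OF that(1), of v] that by simp
    have 2: "laplacian_entry G (Inr u) (Inl v) = laplacian_entry G2 u v"
      if "u \<notin> ?U" "v \<in> ?U" for u v using laplacian_interior2[OF that(1), of v] that by simp
    have 3: "laplacian_entry G (Inl v) (Inr u) = laplacian_entry G2 u v"
      if "u \<notin> ?U" "v \<in> ?U" for u v using 2[OF that] by (simp add: laplacian_entry_sym)
    show ?thesis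
      using q A2 C2 E B2 D1 D2 L mem2 memU
      by (intro eq_matI)
        (auto simp: Z_def interior_block_def boundary_block_def C2_def E_def laplacian_block_def m2_def e2_def
          append_enum_def truncate_cols_def truncate_mat_def laplacian_def 1 2 3 laplacian_boundary)
  qed
  have "mat (m1 + (m2 + q)) (m1 + (m2 + q)) (\<lambda>(i, j). laplacian_entry G (e i) (e j))
      = four_block_mat ?A1 X (transpose_mat X) Z" (is "?L = ?R")
  proof (rule eq_matI)
    have 1: "laplacian_entry G (Inl u) (Inr v) = 0" "laplacian_entry G (Inr v) (Inl u) = 0"
      if "u \<notin> ?U" for u v using laplacian_interior12[OF that] by (simp_all add: laplacian_entry_sym)
    have 2: "laplacian_entry G (Inl v) (Inl u) = laplacian_entry G1 u v"
      "laplacian_entry G (Inl u) (Inl v) = laplacian_entry G1 u v"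
      if "u \<notin> ?U" for u v using laplacian_interior1[OF that] laplacian_entry_sym by metis+
    have X_entry: "laplacian_entry G (Inl (from_nat_into ?I1 i)) (e2 j) = X $$ (i, j)"
      "laplacian_entry G (e2 j) (Inl (from_nat_into ?I1 i)) = X $$ (i, j)" if "i < m1" "j < m2 + q" for i j
      using that q B1 mem1
      by (auto simp: X_def C1_def e2_def append_enum_def boundary_block_def laplacian_block_def m1_def
          truncate_cols_def 1 2)
    fix i j assume "i < dim_row ?R" "j < dim_col ?R"
    then have "i < m1 + (m2 + q)" "j < m1 + (m2 + q)" using A1 Z by auto
    then show "?L $$ (i, j) = ?R $$ (i, j)"
      using A1 Z X mem1 unfolding mid[symmetric]
      by (auto simp: e_def append_enum_def X_entry interior_block_def laplacian_block_def m1_def 2(2))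
  qed (use A1 Z in auto)
  then have "real (num_spanning_trees G) = det (four_block_mat ?A1 X (transpose_mat X) Z)"
    using matrix_tree[OF fin_simple_G _ e] y Y_sub by (auto simp: uverts_glue[OF Y_sub(1)])
  also have "\<dots> = det ?A1 * det (Z - transpose_mat X * W1 * X)"
    using A1 W1 X Z by (intro det_schur_complement) auto
  also have "Z - transpose_mat X * W1 * X
      = four_block_mat ?A2 C2 (transpose_mat C2) (E - transpose_mat C1 * W1 * C1)"
  proof (rule eq_matI)
    fix i j
    assume "i < dim_row (four_block_mat ?A2 C2 (transpose_mat C2) (E - transpose_mat C1 * W1 * C1))"
      "j < dim_col (four_block_mat ?A2 C2 (transpose_mat C2) (E - transpose_mat C1 * W1 * C1))"
    then have ij: "i < m2 + q" "j < m2 + q" using A2 C1 by auto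
    have "(transpose_mat X * W1 * X) $$ (i, j) = (\<Sum>a<m1. \<Sum>b<m1. X $$ (a, i) * W1 $$ (a, b) * X $$ (b, j))"
      using X W1(1) ij by (rule transpose_mult_mult_index)
    also have "\<dots> = (if i < m2 \<or> j < m2 then 0 else (transpose_mat C1 * W1 * C1) $$ (i - m2, j - m2))"
      using ij transpose_mult_mult_index[OF C1 W1(1), of "i - m2" "j - m2"]
      by (auto simp: X_def intro!: sum.neutral sum.cong)
    finally show "(Z - transpose_mat X * W1 * X) $$ (i, j) =
        four_block_mat ?A2 C2 (transpose_mat C2) (E - transpose_mat C1 * W1 * C1) $$ (i, j)"
      using ij A2 C2 C1 E X Z by (simp add: Z_def)
  qed (use A2 C1 X E in \<open>auto simp: Z_def\<close>)
  also have "det \<dots> = det ?A2 * det (E - transpose_mat C1 * W1 * C1 - transpose_mat C2 * W2 * C2)"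
    using A2 W2 C2 C1 W1 E
    by (intro det_schur_complement) (auto intro!: minus_carrier_mat mult_carrier_mat)
  also have "E - transpose_mat C1 * W1 * C1 - transpose_mat C2 * W2 * C2 = truncate_mat (DN_glue G1 Y G2)"
  proof -
    have S1: "transpose_mat ?B1 * W1 * ?B1 \<in> carrier_mat (Suc q) (Suc q)"
      using B1 W1 by (auto intro!: mult_carrier_mat)
    have S2: "transpose_mat ?B2 * W2 * ?B2 \<in> carrier_mat (Suc q) (Suc q)"
      using B2 W2 by (auto intro!: mult_carrier_mat)
    have "truncate_mat (?D1 + ?D2 - laplacian Y) - truncate_mat S1 - truncate_mat S2
        = truncate_mat ((?D1 - S1) + (?D2 - S2) - laplacian Y)"
      if "S1 \<in> carrier_mat (Suc q) (Suc q)" "S2 \<in> carrier_mat (Suc q) (Suc q)" for S1 S2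
      using that D1 D2 L by (intro eq_matI) (auto simp: truncate_mat_def)
    from this[OF S1 S2] show ?thesis
      unfolding DN_glue_def DN1 DN2 C1_def C2_def E_def
        truncate_transpose_mult_mult[OF B1 W1(1), symmetric] truncate_transpose_mult_mult[OF B2 W2(1), symmetric] .
  qed
  finally show ?thesis by (simp add: mult.assoc)
qed

lemma pseudo_det_DN_glue:
  "of_real (det (interior_block G1 Y)) * of_real (det (interior_block G2 Y)) * pseudo_det (DN_glue G1 Y G2) =
    of_nat (card (uverts Y)) * of_nat (num_spanning_trees G)"
proof -
  obtain q where q: "card (uverts Y) = Suc q" using Y_nonempty finite_verts by (cases "card (uverts Y)") auto
  note tau = det_truncate_DN_glue
  have "det (truncate_mat (DN_glue G1 Y G2)) \<noteq> 0"
    using tau num_spanning_trees_nonzero[OF fin_simple_G uconnected_G] by auto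
  then have "pseudo_det (DN_glue G1 Y G2) = of_real (of_nat (Suc q) * det (truncate_mat (DN_glue G1 Y G2)))"
    using DN_glue_zero_line_sums unfolding q by (intro pseudo_det_zero_line_sums)
  then have "of_real (det (interior_block G1 Y)) * of_real (det (interior_block G2 Y)) * pseudo_det (DN_glue G1 Y G2) =
      of_real (of_nat (Suc q) *
        (det (interior_block G1 Y) * det (interior_block G2 Y) * det (truncate_mat (DN_glue G1 Y G2))))"
    by (simp add: mult_ac)
  also have "\<dots> = of_nat (Suc q) * of_nat (num_spanning_trees G)"
    unfolding tau by (simp del: of_nat_Suc)
  finally show ?thesis unfolding q .
qed

lemma spanning_trees_glue:
  "of_nat (num_spanning_trees G) =
    of_nat (num_spanning_trees G1) * of_nat (num_spanning_trees G2) * glue_factor G1 G2 Y"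
proof -
  define k :: complex where "k = of_nat (card (uverts Y))"
  define a1 a2 :: complex where "a1 = of_real (det (interior_block G1 Y))" and "a2 = of_real (det (interior_block G2 Y))"
  define t1 t2 t :: complex where "t1 = of_nat (num_spanning_trees G1)" and "t2 = of_nat (num_spanning_trees G2)"
    and "t = of_nat (num_spanning_trees G)"
  define p1 p2 p where "p1 = pseudo_det (DN G1 Y)" and "p2 = pseudo_det (DN G2 Y)"
    and "p = pseudo_det (DN_glue G1 Y G2)"
  have k: "k \<noteq> 0" using Y_nonempty finite_verts by (simp add: k_def)
  have tn: "t1 \<noteq> 0" "t2 \<noteq> 0"
    using num_spanning_trees_nonzero[OF G1] num_spanning_trees_nonzero[OF G2] by (simp_all add: t1_def t2_def)
  have e1: "a1 * p1 = k * t1"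
    unfolding a1_def p1_def k_def t1_def by (rule pseudo_det_DN[OF G1 Y_nonempty Y_sub(1)])
  have e2: "a2 * p2 = k * t2"
    unfolding a2_def p2_def k_def t2_def by (rule pseudo_det_DN[OF G2 Y_nonempty Y_sub(2)])
  have e: "a1 * a2 * p = k * t"
    unfolding a1_def a2_def p_def k_def t_def by (rule pseudo_det_DN_glue)
  have nz: "a1 \<noteq> 0" "a2 \<noteq> 0" "p1 \<noteq> 0" "p2 \<noteq> 0" using e1 e2 k tn by auto
  \<comment> \<open>The determinants of the interior blocks, \<open>a1\<close> and \<open>a2\<close>, cancel here.\<close>
  have "(k * t1) * (k * t2) * p = k * t * (p1 * p2)"
    unfolding e1[symmetric] e2[symmetric] e[symmetric] by (simp add: mult_ac)
  then have "t1 * t2 * (k * p) = t * (p1 * p2)" using k by (simp add: mult_ac)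
  then have "t = t1 * t2 * (k * p / (p1 * p2))" using nz by (simp add: field_simps)
  then show ?thesis
    unfolding glue_factor_def k_def p1_def p2_def p_def t1_def t2_def t_def .
qed

end

theorem theorem3p3:
  fixes G1 G2 Y :: "'a ugraph"
  assumes "fin_simple_graph G1" and "uconnected G1"
    and "fin_simple_graph G2" and "uconnected G2"
    and "uverts Y \<noteq> {}"
    and "full_subgraph Y G1" and "full_subgraph Y G2"
  shows "of_nat (num_spanning_trees (glue G1 Y G2)) =
    of_nat (num_spanning_trees G1) * of_nat (num_spanning_trees G2) * glue_factor G1 G2 Y"
proof -
  interpret gluing G1 G2 Y
    using assms by unfold_locales
  show ?thesis by (rule spanning_trees_glue)
qed

end
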